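(* Consider charging $N$ $d$-level batteries from $\rho^{\otimes N}$ to $\sigma^{\otimes N}$ by a general time-dependent collective Hamiltonian $\bm H(t)=\sum_\mu h_\mu(t)$ in which each term $h_\mu(t)$ acts on at most $k$ batteries (interaction order $k$), and at every time each battery participates in at most $m$ of the terms (maximum participation number $m$); the supports of different terms may overlap. If the procedure satisfies constraint (C0), then $\Gamma_{\rm C0}<\gamma\big(k^2(m-1)+k\big)$, where $\gamma$ is a constant depending only on the single-battery data ($I$, $\rho$, $\sigma$, and the optimal single-battery charging protocol) and not on $N$ (with $\gamma=\pi/2$ when $\rho$ is the ground state and $\sigma$ the maximally excited state of $I$).
   Context: Each battery is a $d$-level system with internal Hamiltonian $I^{(j)}=\sum_{l=1}^d\lambda_l|l\rangle_j\langle l|_j$, eigenvalues increasing, with $\lambda_d-\lambda_1=2\lambda_d>0$; the total internal Hamiltonian is $\bm I=\sum_j I^{(j)}$. Charging is unitary evolution under the time-dependent Hamiltonian; work is $W=\mathrm{tr}[\bm I(\text{final}-\text{initial})]$. The quantum advantage is $\Gamma=T_\|/T_\sharp$, where $T_\|$ is the optimal time to take $\rho$ to $\sigma$ with a single-battery Hamiltonian $H(t)$ (charging the $N$ batteries in parallel) and $T_\sharp$ the time of the collective protocol taking $\rho^{\otimes N}$ to $\sigma^{\otimes N}$. Constraint (C0): $\frac1{T_\sharp}\int_0^{T_\sharp}\|\bm H\|_{\rm op}dt\le N\,\frac1{T_\|}\int_0^{T_\|}\|H\|_{\rm op}dt$, where $\|\cdot\|_{\rm op}$ is the largest singular value. 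*)

theory Defs
  imports "HOL-Analysis.Analysis"
begin

text \<open>Basis configurations of N d-level batteries: maps j \<mapsto> level of battery j (j < N).\<close>
definition cfg :: "nat \<Rightarrow> nat \<Rightarrow> (nat \<Rightarrow> nat) set" where
  "cfg N d = PiE {..<N} (\<lambda>_. {..<d})"

text \<open>Operators on the N-battery space, given by their matrix entries in the product basis.\<close>
type_synonym op = "(nat \<Rightarrow> nat) \<Rightarrow> (nat \<Rightarrow> nat) \<Rightarrow> complex"

definition idop :: op where "idop x y = (if x = y then 1 else 0)"

definition mmul :: "nat \<Rightarrow> nat \<Rightarrow> op \<Rightarrow> op \<Rightarrow> op" where
  "mmul N d A B = (\<lambda>x y. \<Sum>z\<in>cfg N d. A x z * B z y)"

definition adj :: "op \<Rightarrow> op" where "adj A = (\<lambda>x y. cnj (A y x))"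

definition hermitian :: "nat \<Rightarrow> nat \<Rightarrow> op \<Rightarrow> bool" where
  "hermitian N d A \<longleftrightarrow> (\<forall>x\<in>cfg N d. \<forall>y\<in>cfg N d. A x y = cnj (A y x))"

definition vnorm :: "nat \<Rightarrow> nat \<Rightarrow> ((nat \<Rightarrow> nat) \<Rightarrow> complex) \<Rightarrow> real" where
  "vnorm N d v = sqrt (\<Sum>x\<in>cfg N d. (cmod (v x))\<^sup>2)"

definition apply_op :: "nat \<Rightarrow> nat \<Rightarrow> op \<Rightarrow> ((nat \<Rightarrow> nat) \<Rightarrow> complex) \<Rightarrow> ((nat \<Rightarrow> nat) \<Rightarrow> complex)" where
  "apply_op N d A v = (\<lambda>x. \<Sum>y\<in>cfg N d. A x y * v y)"

definition opnorm :: "nat \<Rightarrow> nat \<Rightarrow> op \<Rightarrow> real" where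
  "opnorm N d A = Sup {vnorm N d (apply_op N d A v) | v. vnorm N d v = 1}"

definition tpow :: "nat \<Rightarrow> (nat \<Rightarrow> nat \<Rightarrow> complex) \<Rightarrow> op" where
  "tpow N A = (\<lambda>x y. \<Prod>j<N. A (x j) (y j))"

definition density :: "nat \<Rightarrow> (nat \<Rightarrow> nat \<Rightarrow> complex) \<Rightarrow> bool" where
  "density d \<rho> \<longleftrightarrow> (\<forall>i<d. \<forall>j<d. \<rho> i j = cnj (\<rho> j i))
     \<and> (\<forall>v :: nat \<Rightarrow> complex. 0 \<le> Re (\<Sum>i<d. \<Sum>j<d. cnj (v i) * \<rho> i j * v j))
     \<and> (\<Sum>i<d. \<rho> i i) = 1"

definition schroedinger :: "nat \<Rightarrow> nat \<Rightarrow> (real \<Rightarrow> op) \<Rightarrow> (real \<Rightarrow> op) \<Rightarrow> real \<Rightarrow> bool" where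
  "schroedinger N d H U T \<longleftrightarrow>
     (\<forall>t\<in>{0..T}. \<forall>x\<in>cfg N d. \<forall>y\<in>cfg N d.
        ((\<lambda>s. - \<i> * (\<Sum>z\<in>cfg N d. H s x z * U s z y)) has_integral (U t x y - idop x y)) {0..t})"

definition charges :: "nat \<Rightarrow> nat \<Rightarrow> op \<Rightarrow> op \<Rightarrow> (real \<Rightarrow> op) \<Rightarrow> real \<Rightarrow> bool" where
  "charges N d A B H T \<longleftrightarrow> T > 0 \<and> (\<forall>t\<in>{0..T}. hermitian N d (H t))
     \<and> (\<lambda>t. opnorm N d (H t)) integrable_on {0..T}
     \<and> (\<exists>U. schroedinger N d H U T \<and>
          (\<forall>x\<in>cfg N d. \<forall>y\<in>cfg N d.
             mmul N d (mmul N d (U T) A) (adj (U T)) x y = B x y))"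

definition avg_norm :: "nat \<Rightarrow> nat \<Rightarrow> (real \<Rightarrow> op) \<Rightarrow> real \<Rightarrow> real" where
  "avg_norm N d H T = integral {0..T} (\<lambda>t. opnorm N d (H t)) / T"

definition optimal_single ::
  "nat \<Rightarrow> (nat \<Rightarrow> nat \<Rightarrow> complex) \<Rightarrow> (nat \<Rightarrow> nat \<Rightarrow> complex) \<Rightarrow> (real \<Rightarrow> nat \<Rightarrow> nat \<Rightarrow> complex) \<Rightarrow> real \<Rightarrow> bool" where
  "optimal_single d \<rho> \<sigma> H1 T1 \<longleftrightarrow>
     charges 1 d (tpow 1 \<rho>) (tpow 1 \<sigma>) (\<lambda>t. tpow 1 (H1 t)) T1 \<and>
     (\<forall>H' T'. charges 1 d (tpow 1 \<rho>) (tpow 1 \<sigma>) H' T'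
        \<and> avg_norm 1 d H' T' \<le> avg_norm 1 d (\<lambda>t. tpow 1 (H1 t)) T1 \<longrightarrow> T1 \<le> T')"

text \<open>Operator h acts (nontrivially) only on the batteries in S: h = g_S \<otimes> 1.\<close>
definition acts_on :: "nat \<Rightarrow> nat \<Rightarrow> nat set \<Rightarrow> op \<Rightarrow> bool" where
  "acts_on N d S h \<longleftrightarrow> (\<exists>g :: op. \<forall>x\<in>cfg N d. \<forall>y\<in>cfg N d.
      h x y = (if (\<forall>j\<in>{..<N} - S. x j = y j) then g (restrict x S) (restrict y S) else 0))"

definition local_hamiltonian ::
  "nat \<Rightarrow> nat \<Rightarrow> nat \<Rightarrow> nat \<Rightarrow> nat set \<Rightarrow> (nat \<Rightarrow> real \<Rightarrow> op) \<Rightarrow> (nat \<Rightarrow> real \<Rightarrow> nat set)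
     \<Rightarrow> (real \<Rightarrow> op) \<Rightarrow> real \<Rightarrow> bool" where
  "local_hamiltonian N d k m M h S H T \<longleftrightarrow> finite M \<and>
     (\<forall>t\<in>{0..T}.
        (\<forall>x\<in>cfg N d. \<forall>y\<in>cfg N d. H t x y = (\<Sum>\<mu>\<in>M. h \<mu> t x y)) \<and>
        (\<forall>\<mu>\<in>M. S \<mu> t \<subseteq> {..<N} \<and> card (S \<mu> t) \<le> k \<and>
                hermitian N d (h \<mu> t) \<and> acts_on N d (S \<mu> t) (h \<mu> t)) \<and>
        (\<forall>j<N. card {\<mu>\<in>M. j \<in> S \<mu> t} \<le> m))"

end

theory Submission
  imports Defs
begin

text \<open>
  Fix a single-battery level (in a suitable basis) and let \<open>n(x)\<close> count the batteries of a configuration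
  \<open>x\<close> sitting in it. A term acting on at most \<open>k\<close> batteries changes \<open>n\<close> by at most \<open>k\<close>, so every
  Hamiltonian of interaction order \<open>k\<close> is a band matrix for the grading \<open>n\<close>. A discrete form of
  Bernstein's inequality bounds the commutator of such an \<open>H\<close> with \<open>n\<close> by \<open>k\<close> times the operator norm of
  \<open>H\<close>. Hence the expected population of the level, which has to change
  by \<open>N\<close> times a single-battery constant, changes by at most \<open>k\<close> times the integral of the norm,
  and (C0) turns this into a lower bound on the charging time.

  The level and basis are chosen so that the populations of \<open>\<rho>\<close> and \<open>\<sigma>\<close> differ; this is possible because an
  optimal single-battery protocol cannot exist when \<open>\<rho> = \<sigma>\<close>. From the ground to the maximally excited
  state the constant is \<open>1\<close>, and comparison with the Rabi flip of duration \<open>\<pi> / (2 E)\<close> shows that the optimal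
  protocol has \<open>T1 E \<le> \<pi> / 2\<close>.
\<close>

section \<open>Norm squares of indefinite integrals\<close>

text \<open>The evolution is given only as a Henstock-Kurzweil integral equation, and of the
  Hamiltonian's time dependence one knows little more than that its norm is integrable. Populations
  can therefore not be differentiated pointwise; their rate of change is recovered in integrated
  form. Mixed states are handled by writing \<rho> as a sum of rank-one Gram terms. The squared
  norms of the resulting product vectors sum to one, so an estimate for single vectors adds up
  without any loss growing with \<open>N\<close>. The change of basis is a tensor power of a
  one-battery matrix, so no term acts on more batteries afterwards than before. The matrix is taken
  Hermitian with square one: it is then its own adjoint and inverse, and it can also serve as the
  Hamiltonian of a flip. The two claims obtain strictness differently. In general the constant may
  be enlarged. For full charging it is prescribed, so strictness must come from the
  dynamics.\<close>

lemma norm_square_has_integral: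
  fixes \<phi> f :: "real \<Rightarrow> complex"
  assumes ab: "a \<le> b"
    and f: "f absolutely_integrable_on {a..b}"
    and \<phi>: "\<And>t. t \<in> {a..b} \<Longrightarrow> (f has_integral \<phi> t - \<phi> a) {a..t}"
  shows "((\<lambda>s. 2 * Re (cnj (\<phi> s) * f s)) has_integral (cmod (\<phi> b))\<^sup>2 - (cmod (\<phi> a))\<^sup>2) {a..b}"
proof -
  define g where "g = (\<lambda>s. 2 * Re (cnj (\<phi> s) * f s))"
  have fi: "f integrable_on {a..b}" and ni: "(\<lambda>s. cmod (f s)) integrable_on {a..b}"
    using f unfolding absolutely_integrable_on_def by auto
  have "continuous_on {a..b} (\<lambda>t. \<phi> a + integral {a..t} f)"
    by (intro continuous_intros indefinite_integral_continuous_1 fi)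
  moreover have "\<phi> a + integral {a..t} f = \<phi> t" if "t \<in> {a..b}" for t
    using integral_unique[OF \<phi>[OF that]] by simp
  ultimately have cont: "continuous_on {a..b} \<phi>"
    by (simp cong: continuous_on_cong_simp)
  \<comment> \<open>Absolute integrability is essential here: a Henstock-Kurzweil integrable
    function times a merely continuous one need not be integrable.\<close>
  have "(\<lambda>s. cnj (\<phi> s) * f s) absolutely_integrable_on {a..b}"
  proof (rule absolutely_integrable_bounded_measurable_product[where h="(*)", OF _ _ _ _ f])
    show "bilinear ((*) :: complex \<Rightarrow> complex \<Rightarrow> complex)"
      using bilinear_times by blast
    have c: "continuous_on {a..b} (\<lambda>s. cnj (\<phi> s))"
      by (intro continuous_intros cont)
    show "(\<lambda>s. cnj (\<phi> s)) \<in> borel_measurable (lebesgue_on {a..b})"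
      by (rule continuous_imp_measurable_on_sets_lebesgue[OF c]) auto
    show "bounded ((\<lambda>s. cnj (\<phi> s)) ` {a..b})"
      by (intro compact_imp_bounded compact_continuous_image c) auto
  qed auto
  then have "(\<lambda>s. cnj (\<phi> s) * f s) integrable_on {a..b}"
    unfolding absolutely_integrable_on_def by auto
  then have "(\<lambda>s. Re (cnj (\<phi> s) * f s)) integrable_on {a..b}"
    by (rule integrable_linear[OF _ bounded_linear_Re, unfolded o_def])
  then have gi: "g integrable_on {a..b}"
    unfolding g_def by (rule integrable_on_mult_right)
  define D where "D s t = (cmod (\<phi> t))\<^sup>2 - (cmod (\<phi> s))\<^sup>2 - integral {s..t} g" for s t
  \<comment> \<open>\<open>D\<close> is the defect of the claimed identity. Both \<open>D\<close>
    and the integral of \<open>cmod (f s)\<close> are additive over adjacent intervals, so the bound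
    need only be checked on short intervals and is glued by bisection.\<close>
  have small: "\<bar>D a b\<bar> \<le> e * integral {a..b} (\<lambda>s. cmod (f s))" if e: "e > 0" for e
  proof -
    define P where "P s t \<longleftrightarrow> (a \<le> s \<and> s \<le> t \<and> t \<le> b \<longrightarrow>
      \<bar>D s t\<bar> \<le> e * integral {s..t} (\<lambda>s. cmod (f s)))" for s t
    from ab have "P a b"
    proof (induction rule: Bolzano)
      case (trans s t u)
      show ?case unfolding P_def
      proof (intro impI)
        assume u: "a \<le> s \<and> s \<le> u \<and> u \<le> b"
        have combine: "integral {s..t} g + integral {t..u} g = integral {s..u} g"
          using trans u by (intro Henstock_Kurzweil_Integration.integral_combine
              integrable_on_subinterval[OF gi]) auto
        have combine': "integral {s..t} (\<lambda>s. cmod (f s)) + integral {t..u} (\<lambda>s. cmod (f s))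
            = integral {s..u} (\<lambda>s. cmod (f s))"
          using trans u by (intro Henstock_Kurzweil_Integration.integral_combine
              integrable_on_subinterval[OF ni]) auto
        have "\<bar>D s t\<bar> \<le> e * integral {s..t} (\<lambda>s. cmod (f s))"
          "\<bar>D t u\<bar> \<le> e * integral {t..u} (\<lambda>s. cmod (f s))"
          using trans u unfolding P_def by auto
        moreover have "D s u = D s t + D t u" unfolding D_def using combine by simp
        ultimately show "\<bar>D s u\<bar> \<le> e * integral {s..u} (\<lambda>s. cmod (f s))"
          unfolding combine'[symmetric] distrib_left by linarith
      qed
    next
      case (local x)
      \<comment> \<open>The tolerance is \<open>e / 4\<close> because the estimate below involves
        the distance to \<open>\<phi> x\<close> once at each endpoint and twice at the interior
        point.\<close>
      obtain d where d: "d > 0" "\<And>y. y \<in> {a..b} \<Longrightarrow> dist y x < d \<Longrightarrow> dist (\<phi> y) (\<phi> x) < e / 4"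
        using cont[unfolded continuous_on_iff, rule_format, of x "e / 4"] local e by auto
      have "P s t" if st: "s \<le> x" "x \<le> t" "t - s < d" for s t
        unfolding P_def
      proof (intro impI)
        assume ast: "a \<le> s \<and> s \<le> t \<and> t \<le> b"
        have near: "cmod (\<phi> y - \<phi> x) < e / 4" if "y \<in> {s..t}" for y
          using d(2)[of y] that st ast by (auto simp: dist_norm)
        have gst: "g integrable_on {s..t}" and nst: "(\<lambda>s. cmod (f s)) integrable_on {s..t}"
          and fst: "f integrable_on {s..t}"
          using ast by (auto intro: integrable_on_subinterval[OF gi] integrable_on_subinterval[OF ni]
              integrable_on_subinterval[OF fi])
        have "integral {a..s} f + integral {s..t} f = integral {a..t} f"
          using ast by (intro Henstock_Kurzweil_Integration.integral_combine
              integrable_on_subinterval[OF fi]) auto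
        moreover have "integral {a..s} f = \<phi> s - \<phi> a" "integral {a..t} f = \<phi> t - \<phi> a"
          using ast by (auto intro!: integral_unique \<phi>)
        ultimately have "integral {s..t} f = \<phi> t - \<phi> s" by (simp add: algebra_simps)
        then have "(f has_integral \<phi> t - \<phi> s) {s..t}"
          using integrable_integral[OF fst] by simp
        \<comment> \<open>With the endpoint sum in place of twice the running value, the increment
          of the squared norm is an exact identity: the polarised difference of squares. The defect
          on a short interval is thus caused only by the oscillation of \<phi>.\<close>
        then have "((\<lambda>\<tau>. (cnj (\<phi> t) + cnj (\<phi> s)) * f \<tau>) has_integral
            (cnj (\<phi> t) + cnj (\<phi> s)) * (\<phi> t - \<phi> s)) {s..t}"
          by (rule has_integral_mult_right)
        then have 1: "((\<lambda>\<tau>. Re ((cnj (\<phi> t) + cnj (\<phi> s)) * f \<tau>)) has_integral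
            Re ((cnj (\<phi> t) + cnj (\<phi> s)) * (\<phi> t - \<phi> s))) {s..t}"
          by (rule has_integral_linear[OF _ bounded_linear_Re, unfolded o_def])
        have 2: "Re ((cnj (\<phi> t) + cnj (\<phi> s)) * (\<phi> t - \<phi> s)) = (cmod (\<phi> t))\<^sup>2 - (cmod (\<phi> s))\<^sup>2"
          unfolding cmod_power2 by (simp add: power2_eq_square algebra_simps)
        have int: "((\<lambda>\<tau>. Re ((cnj (\<phi> t) + cnj (\<phi> s)) * f \<tau>) - g \<tau>) has_integral D s t) {s..t}"
          unfolding D_def using has_integral_diff[OF 1 integrable_integral[OF gst]] 2 by simp
        then have "(\<lambda>\<tau>. Re ((cnj (\<phi> t) + cnj (\<phi> s)) * f \<tau>) - g \<tau>) integrable_on {s..t}"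
          by (rule has_integral_integrable)
        moreover have "\<bar>Re ((cnj (\<phi> t) + cnj (\<phi> s)) * f \<tau>) - g \<tau>\<bar> \<le> e * cmod (f \<tau>)"
          if "\<tau> \<in> {s..t}" for \<tau>
        proof -
          have "Re ((cnj (\<phi> t) + cnj (\<phi> s)) * f \<tau>) - g \<tau>
              = Re (cnj ((\<phi> t - \<phi> x) + (\<phi> s - \<phi> x) - 2 * (\<phi> \<tau> - \<phi> x)) * f \<tau>)"
            unfolding g_def by (simp add: algebra_simps)
          also have "\<bar>\<dots>\<bar> \<le> cmod (cnj ((\<phi> t - \<phi> x) + (\<phi> s - \<phi> x) - 2 * (\<phi> \<tau> - \<phi> x)) * f \<tau>)"
            by (rule abs_Re_le_cmod)
          also have "\<dots> = cmod ((\<phi> t - \<phi> x) + (\<phi> s - \<phi> x) - 2 * (\<phi> \<tau> - \<phi> x)) * cmod (f \<tau>)"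
            by (simp only: norm_mult complex_mod_cnj)
          also have "\<dots> \<le> e * cmod (f \<tau>)"
          proof (rule mult_right_mono)
            have "cmod ((\<phi> t - \<phi> x) + (\<phi> s - \<phi> x) - 2 * (\<phi> \<tau> - \<phi> x))
                \<le> cmod (\<phi> t - \<phi> x) + cmod (\<phi> s - \<phi> x) + cmod (2 * (\<phi> \<tau> - \<phi> x))"
              by (rule order_trans[OF norm_triangle_ineq4 add_right_mono[OF norm_triangle_ineq]])
            also have "\<dots> \<le> e"
              unfolding norm_mult norm_numeral
              using near[of t] near[of s] near[OF that] ast by auto
            finally show "cmod ((\<phi> t - \<phi> x) + (\<phi> s - \<phi> x) - 2 * (\<phi> \<tau> - \<phi> x)) \<le> e" .
          qed simp
          finally show ?thesis .
        qed
        ultimately have "norm (integral {s..t} (\<lambda>\<tau>. Re ((cnj (\<phi> t) + cnj (\<phi> s)) * f \<tau>) - g \<tau>))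
            \<le> integral {s..t} (\<lambda>\<tau>. e * cmod (f \<tau>))"
          by (intro integral_norm_bound_integral integrable_on_mult_right nst) auto
        moreover have "integral {s..t} (\<lambda>\<tau>. Re ((cnj (\<phi> t) + cnj (\<phi> s)) * f \<tau>) - g \<tau>) = D s t"
          using int by (rule integral_unique)
        ultimately show "\<bar>D s t\<bar> \<le> e * integral {s..t} (\<lambda>s. cmod (f s))" by simp
      qed
      with d(1) show ?case by blast
    qed
    then show ?thesis using ab unfolding P_def by auto
  qed
  have "\<bar>D a b\<bar> \<le> 0"
  proof (rule field_le_epsilon)
    fix e :: real assume e: "e > 0"
    define c where "c = integral {a..b} (\<lambda>s. cmod (f s)) + 1"
    have c: "c \<ge> 1" unfolding c_def by (simp add: integral_nonneg ni)
    have "\<bar>D a b\<bar> \<le> (e / c) * (c - 1)"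
      using small[of "e / c"] e c unfolding c_def by simp
    also have "\<dots> \<le> e" using e c by (simp add: field_simps)
    finally show "\<bar>D a b\<bar> \<le> 0 + e" by simp
  qed
  then have "integral {a..b} g = (cmod (\<phi> b))\<^sup>2 - (cmod (\<phi> a))\<^sup>2" unfolding D_def by simp
  then show ?thesis using integrable_integral[OF gi] unfolding g_def by simp
qed

section \<open>Bernstein's inequality for band matrices\<close>

text \<open>The values have modulus one so that multiplying a vector by them keeps its norm. The
  period \<open>4 * k\<close> gives the autocorrelation linear flanks of length
  \<open>2 * k\<close>, which is the range of grading differences, from -k to k, that a band matrix
  allows.\<close>

definition square_wave :: "nat \<Rightarrow> nat \<Rightarrow> real" where
  "square_wave k p = (if p mod (4 * k) < 2 * k then 1 else - 1)"

lemma abs_square_wave [simp]: "\<bar>square_wave k p\<bar> = 1"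
  by (simp add: square_wave_def)

lemma sum_lessThan_periodic_shift:
  fixes F :: "nat \<Rightarrow> 'b::ab_group_add"
  assumes "\<And>p. F (p + L) = F p"
  shows "(\<Sum>p<L. F (p + a)) = (\<Sum>p<L. F p)"
proof (induction a)
  case (Suc a)
  have "(\<Sum>p<L. F (p + Suc a)) + F a = (\<Sum>p<Suc L. F (p + a))"
    by (subst sum.lessThan_Suc_shift) (simp add: add.commute)
  also have "\<dots> = (\<Sum>p<L. F (p + a)) + F a"
    using assms[of a] by (simp add: add.commute)
  finally show ?case using Suc.IH by simp
qed simp

text \<open>The autocorrelation of the square wave is a triangle wave, which is linear on the range needed.\<close>

lemma square_wave_autocorrelation_origin:
  assumes "c \<le> 2 * k"
  shows "(\<Sum>p<4 * k. square_wave k p * square_wave k (p + c)) = 4 * (real k - real c)"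
proof -
  let ?f = "\<lambda>p. square_wave k p * square_wave k (p + c)"
  have val: "?f p = (if p + c < 2 * k \<or> 2 * k \<le> p \<and> p + c < 4 * k then 1 else - 1)" if "p < 4 * k" for p
  proof (cases "p + c < 4 * k")
    case True
    then have "(p + c) mod (4 * k) = p + c" "p mod (4 * k) = p" using that
      by (simp_all only: mod_less)
    then have "square_wave k p = (if p < 2 * k then 1 else - 1)"
      "square_wave k (p + c) = (if p + c < 2 * k then 1 else - 1)"
      by (simp_all only: square_wave_def)
    then show ?thesis using True by auto
  next
    case False
    then have "(p + c) mod (4 * k) = p + c - 4 * k" using that assms
      by (simp add: le_mod_geq)
    then show ?thesis using that assms False by (auto simp: square_wave_def)
  qed
  have "(\<Sum>p<4 * k. ?f p) = (\<Sum>p\<in>{0..<4 * k}. ?f p)" by (simp add: atLeast0LessThan)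
  \<comment> \<open>Over one period the wave and its shift by \<open>c\<close> agree, disagree,
    agree and disagree, on blocks of lengths \<open>2 * k - c\<close>, \<open>c\<close>,
    \<open>2 * k - c\<close>, \<open>c\<close>.\<close>
  also have "\<dots> = (\<Sum>p\<in>{0..<2 * k - c}. ?f p) + (\<Sum>p\<in>{2 * k - c..<2 * k}. ?f p)
      + (\<Sum>p\<in>{2 * k..<4 * k - c}. ?f p) + (\<Sum>p\<in>{4 * k - c..<4 * k}. ?f p)"
  proof -
    have "0 \<le> 2 * k - c" "2 * k - c \<le> 2 * k" "0 \<le> 2 * k" "2 * k \<le> 4 * k - c"
      "0 \<le> 4 * k - c" "4 * k - c \<le> 4 * k"
      using assms by auto
    then show ?thesis by (simp only: sum.atLeastLessThan_concat)
  qed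
  also have "(\<Sum>p\<in>{0..<2 * k - c}. ?f p) = (\<Sum>p\<in>{0..<2 * k - c}. 1)"
  proof (rule sum.cong[OF refl])
    fix p assume "p \<in> {0..<2 * k - c}"
    then have "p < 4 * k" "(p + c < 2 * k \<or> 2 * k \<le> p \<and> p + c < 4 * k)"
      using assms by auto
    then show "?f p = 1" using val[of p] by presburger
  qed
  also have "(\<Sum>p\<in>{2 * k - c..<2 * k}. ?f p) = (\<Sum>p\<in>{2 * k - c..<2 * k}. - 1)"
  proof (rule sum.cong[OF refl])
    fix p assume "p \<in> {2 * k - c..<2 * k}"
    then have "p < 4 * k" "\<not> (p + c < 2 * k \<or> 2 * k \<le> p \<and> p + c < 4 * k)"
      using assms by auto
    then show "?f p = - 1" using val[of p] by presburger
  qed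
  also have "(\<Sum>p\<in>{2 * k..<4 * k - c}. ?f p) = (\<Sum>p\<in>{2 * k..<4 * k - c}. 1)"
  proof (rule sum.cong[OF refl])
    fix p assume "p \<in> {2 * k..<4 * k - c}"
    then have "p < 4 * k" "(p + c < 2 * k \<or> 2 * k \<le> p \<and> p + c < 4 * k)"
      using assms by auto
    then show "?f p = 1" using val[of p] by presburger
  qed
  also have "(\<Sum>p\<in>{4 * k - c..<4 * k}. ?f p) = (\<Sum>p\<in>{4 * k - c..<4 * k}. - 1)"
  proof (rule sum.cong[OF refl])
    fix p assume "p \<in> {4 * k - c..<4 * k}"
    then have "p < 4 * k" "\<not> (p + c < 2 * k \<or> 2 * k \<le> p \<and> p + c < 4 * k)"
      using assms by auto
    then show "?f p = - 1" using val[of p] by presburger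
  qed
  finally have sum: "(\<Sum>p<4 * k. ?f p) = real (2 * k - c) - real (2 * k - (2 * k - c))
      + real (4 * k - c - 2 * k) - real (4 * k - (4 * k - c))"
    by (simp only: sum_constant card_atLeastLessThan sum_negf diff_zero mult_1_right mult_minus_right)
  have "2 * k - (2 * k - c) = c" "4 * k - c - 2 * k = 2 * k - c" "4 * k - (4 * k - c) = c"
    "real (2 * k - c) = 2 * real k - real c"
    using assms by auto
  note sum = sum[unfolded this]
  have "2 * x - y - y + (2 * x - y) - y = 4 * (x - y)" for x y :: real by simp
  with sum show ?thesis by (rule trans)
qed

text \<open>The extra shift by \<open>k\<close> is a quarter period. It moves the zero of the
  triangle wave to \<open>a = b\<close>, so that the linear flank covers precisely the differences
  of modulus at most \<open>k\<close>. The total lag \<open>b + k - a\<close> is a natural number by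
  the first assumption.\<close>

lemma square_wave_autocorrelation:
  assumes "a \<le> b + k" "b \<le> a + k"
  shows "(\<Sum>p<4 * k. square_wave k (p + a) * square_wave k (p + b + k)) = 4 * (real a - real b)"
proof -
  define c where "c = b + k - a"
  have c: "c \<le> 2 * k" "b + k = a + c" using assms by (auto simp: c_def)
  have eq: "p + b + k = p + a + c" for p using c(2) by linarith
  have "(\<Sum>p<4 * k. square_wave k (p + a) * square_wave k (p + b + k))
      = (\<Sum>p<4 * k. square_wave k (p + a) * square_wave k (p + a + c))"
    by (simp only: eq)
  also have "\<dots> = (\<Sum>p<4 * k. square_wave k p * square_wave k (p + c))"
  proof (rule sum_lessThan_periodic_shift)
    fix p
    have "p + 4 * k + c = (p + c) + 4 * k" by simp
    then show "square_wave k (p + 4 * k) * square_wave k (p + 4 * k + c)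
        = square_wave k p * square_wave k (p + c)"
      by (simp only: square_wave_def mod_add_self2)
  qed
  also have "\<dots> = 4 * (real a - real b)"
    unfolding square_wave_autocorrelation_origin[OF c(1)]
    using arg_cong[OF c(2), of real] by (simp add: algebra_simps)
  finally show ?thesis .
qed

definition sesq :: "'a set \<Rightarrow> ('a \<Rightarrow> 'a \<Rightarrow> complex) \<Rightarrow> ('a \<Rightarrow> complex) \<Rightarrow> ('a \<Rightarrow> complex) \<Rightarrow> complex" where
  "sesq X K u v = (\<Sum>x\<in>X. \<Sum>y\<in>X. cnj (u x) * K x y * v y)"

abbreviation l2norm :: "'a set \<Rightarrow> ('a \<Rightarrow> complex) \<Rightarrow> real" where
  "l2norm X u \<equiv> L2_set (\<lambda>x. cmod (u x)) X"

text \<open>Bernstein's inequality for a band matrix: the triangle wave writes the commutator with the grading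
  as an average of \<open>4 k\<close> conjugates of \<open>K\<close> by diagonal sign matrices.\<close>

lemma sesq_commutator_grading_bound:
  fixes n :: "'a \<Rightarrow> nat"
  assumes bound: "\<And>u v. cmod (sesq X K u v) \<le> \<nu> * l2norm X u * l2norm X v"
    and band: "\<And>x y. x \<in> X \<Longrightarrow> y \<in> X \<Longrightarrow> K x y \<noteq> 0 \<Longrightarrow> n x \<le> n y + k \<and> n y \<le> n x + k"
  shows "cmod (sesq X (\<lambda>x y. of_real (real (n x) - real (n y)) * K x y) u u) \<le> real k * \<nu> * (l2norm X u)\<^sup>2"
proof -
  define a where "a p x = complex_of_real (square_wave k (p + n x)) * u x" for p x
  define b where "b p x = complex_of_real (square_wave k (p + n x + k)) * u x" for p x
  have "cmod (a p x) = cmod (u x)" "cmod (b p x) = cmod (u x)" for p x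
    by (simp_all add: a_def b_def norm_mult)
  then have ab: "l2norm X (a p) = l2norm X u" "l2norm X (b p) = l2norm X u" for p
    by simp_all
  have "(\<Sum>p<4 * k. sesq X K (a p) (b p))
      = (\<Sum>x\<in>X. \<Sum>y\<in>X. \<Sum>p<4 * k. cnj (a p x) * K x y * b p y)"
    unfolding sesq_def by (subst sum.swap, rule sum.cong[OF refl], subst sum.swap, rule refl)
  also have "\<dots> = (\<Sum>x\<in>X. \<Sum>y\<in>X. 4 * (cnj (u x) * (of_real (real (n x) - real (n y)) * K x y) * u y))"
  proof (intro sum.cong refl)
    fix x y assume xy: "x \<in> X" "y \<in> X"
    have "(\<Sum>p<4 * k. cnj (a p x) * K x y * b p y) = cnj (u x) * K x y * u y *
        of_real (\<Sum>p<4 * k. square_wave k (p + n x) * square_wave k (p + n y + k))"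
      by (simp add: a_def b_def sum_distrib_left mult_ac)
    also have "\<dots> = 4 * (cnj (u x) * (of_real (real (n x) - real (n y)) * K x y) * u y)"
    \<comment> \<open>The linear formula holds only for gradings within distance \<open>k\<close>,
      and the band hypothesis supplies this exactly where the entry is nonzero.\<close>
    proof (cases "K x y = 0")
      case False
      then show ?thesis using band[OF xy False] square_wave_autocorrelation[of "n x" "n y" k]
        by (simp add: mult_ac)
    qed simp
    finally show "(\<Sum>p<4 * k. cnj (a p x) * K x y * b p y)
        = 4 * (cnj (u x) * (of_real (real (n x) - real (n y)) * K x y) * u y)" .
  qed
  finally have eq: "4 * sesq X (\<lambda>x y. of_real (real (n x) - real (n y)) * K x y) u u
      = (\<Sum>p<4 * k. sesq X K (a p) (b p))"
    by (simp add: sesq_def sum_distrib_left)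
  have "4 * cmod (sesq X (\<lambda>x y. of_real (real (n x) - real (n y)) * K x y) u u)
      = cmod (\<Sum>p<4 * k. sesq X K (a p) (b p))"
    unfolding eq[symmetric] norm_mult norm_numeral ..
  also have "\<dots> \<le> (\<Sum>p<4 * k. \<nu> * l2norm X u * l2norm X u)"
    by (rule sum_norm_le) (rule bound[of "a _" "b _", unfolded ab])
  finally show ?thesis by (simp add: power2_eq_square mult_ac)
qed

text \<open>Ehrenfest's relation: the rate of change of the expectation of a diagonal observable is
  given by its commutator with the Hamiltonian. Hermiticity turns \<open>cnj S\<close> into the sum
  weighted by the column instead of the row, so \<open>S - cnj S\<close> is the commutator
  form.\<close>

lemma sesq_commutator_hermitian:
  fixes n :: "'a \<Rightarrow> real"
  assumes "\<And>x y. x \<in> X \<Longrightarrow> y \<in> X \<Longrightarrow> K x y = cnj (K y x)"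
  shows "(\<Sum>x\<in>X. n x * (2 * Re (cnj (u x) * (- \<i> * (\<Sum>y\<in>X. K x y * u y)))))
      = Im (sesq X (\<lambda>x y. of_real (n x - n y) * K x y) u u)"
proof -
  define S where "S = (\<Sum>x\<in>X. \<Sum>y\<in>X. of_real (n x) * (cnj (u x) * K x y * u y))"
  have "cnj S = (\<Sum>x\<in>X. \<Sum>y\<in>X. of_real (n x) * (cnj (u y) * K y x * u x))"
    unfolding S_def cnj_sum
  proof (intro sum.cong refl)
    fix x y assume "x \<in> X" "y \<in> X"
    then have "K y x = cnj (K x y)" by (rule assms[rotated])
    then show "cnj (of_real (n x) * (cnj (u x) * K x y * u y)) = of_real (n x) * (cnj (u y) * K y x * u x)"
      by (simp add: mult_ac)
  qed
  also have "\<dots> = (\<Sum>x\<in>X. \<Sum>y\<in>X. of_real (n y) * (cnj (u x) * K x y * u y))"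
    by (rule sum.swap)
  finally have "sesq X (\<lambda>x y. of_real (n x - n y) * K x y) u u = S - cnj S"
    unfolding sesq_def S_def by (simp add: sum_subtractf[symmetric] algebra_simps)
  moreover have "(\<Sum>x\<in>X. n x * (2 * Re (cnj (u x) * (- \<i> * (\<Sum>y\<in>X. K x y * u y))))) = 2 * Im S"
  proof -
    have "S = (\<Sum>x\<in>X. of_real (n x) * (cnj (u x) * (\<Sum>y\<in>X. K x y * u y)))"
      unfolding S_def by (simp add: sum_distrib_left mult_ac)
    then show ?thesis
      by (simp add: sum_distrib_left algebra_simps)
  qed
  ultimately show ?thesis by simp
qed

section \<open>Schroedinger evolution of graded weights\<close>

text \<open>The rate \<open>\<nu>\<close> is kept apart from \<open>K\<close> and only has to bound
  its sesquilinear form. A Hamiltonian in a rotated basis can thus be used together with the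
  operator norm of the original one.\<close>

locale evolution =
  fixes X :: "'a set" and K :: "real \<Rightarrow> 'a \<Rightarrow> 'a \<Rightarrow> complex" and \<nu> :: "real \<Rightarrow> real"
    and \<phi> :: "real \<Rightarrow> 'a \<Rightarrow> complex" and T :: real
  assumes fin: "finite X"
    and T_nonneg: "0 \<le> T"
    and hermitian: "\<And>t x y. t \<in> {0..T} \<Longrightarrow> x \<in> X \<Longrightarrow> y \<in> X \<Longrightarrow> K t x y = cnj (K t y x)"
    and bound: "\<And>t u v. t \<in> {0..T} \<Longrightarrow> cmod (sesq X (K t) u v) \<le> \<nu> t * l2norm X u * l2norm X v"
    and rate_nonneg: "\<And>t. t \<in> {0..T} \<Longrightarrow> 0 \<le> \<nu> t"
    and rate_integrable: "\<nu> integrable_on {0..T}"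
    and evolves: "\<And>t x. t \<in> {0..T} \<Longrightarrow> x \<in> X \<Longrightarrow>
      ((\<lambda>s. - \<i> * (\<Sum>z\<in>X. K s x z * \<phi> s z)) has_integral \<phi> t x - \<phi> 0 x) {0..t}"
begin

definition weight :: "('a \<Rightarrow> real) \<Rightarrow> real \<Rightarrow> real" where
  "weight n t = (\<Sum>x\<in>X. n x * (cmod (\<phi> t x))\<^sup>2)"

lemma velocity_integrable:
  "x \<in> X \<Longrightarrow> (\<lambda>s. - \<i> * (\<Sum>z\<in>X. K s x z * \<phi> s z)) integrable_on {0..T}"
  using evolves[of T x] T_nonneg by auto

lemma continuous_amplitude:
  assumes "x \<in> X"
  shows "continuous_on {0..T} (\<lambda>t. \<phi> t x)"
proof -
  have "continuous_on {0..T} (\<lambda>t. \<phi> 0 x + integral {0..t} (\<lambda>s. - \<i> * (\<Sum>z\<in>X. K s x z * \<phi> s z)))"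
    by (intro continuous_intros indefinite_integral_continuous_1 velocity_integrable assms)
  moreover have "\<phi> 0 x + integral {0..t} (\<lambda>s. - \<i> * (\<Sum>z\<in>X. K s x z * \<phi> s z)) = \<phi> t x"
    if "t \<in> {0..T}" for t
    using integral_unique[OF evolves[OF that assms]] by simp
  ultimately show ?thesis by (simp cong: continuous_on_cong_simp)
qed

lemma continuous_weight: "continuous_on {0..T} (weight n)"
  unfolding weight_def by (intro continuous_intros continuous_amplitude)

lemma velocity_bound:
  assumes "t \<in> {0..T}" "x \<in> X"
  shows "cmod (- \<i> * (\<Sum>z\<in>X. K t x z * \<phi> t z)) \<le> \<nu> t * l2norm X (\<phi> t)"
proof -
  define e where "e y = (if y = x then 1 else 0 :: complex)" for y
  have "(\<Sum>y\<in>X. (cmod (e y))\<^sup>2) = (\<Sum>y\<in>X. if y = x then 1 else 0)"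
    by (intro sum.cong) (auto simp: e_def)
  then have "l2norm X e = 1" using assms(2) fin by (simp add: L2_set_def)
  moreover have "sesq X (K t) e (\<phi> t) = (\<Sum>z\<in>X. K t x z * \<phi> t z)"
  proof -
    have "sesq X (K t) e (\<phi> t) = (\<Sum>y\<in>X. if y = x then (\<Sum>z\<in>X. K t y z * \<phi> t z) else 0)"
      unfolding sesq_def by (intro sum.cong refl) (auto simp: e_def)
    then show ?thesis using assms(2) fin by simp
  qed
  ultimately show ?thesis using bound[OF assms(1), of e "\<phi> t"] by (simp add: norm_mult)
qed

text \<open>The velocity is Henstock-Kurzweil integrable by assumption, and an integrable majorant
  makes it absolutely integrable. The amplitudes are bounded by continuity on a compact interval;
  conservation of the norm cannot be invoked yet, as its proof depends on this lemma.\<close>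

lemma velocity_absolutely_integrable:
  assumes "x \<in> X"
  shows "(\<lambda>s. - \<i> * (\<Sum>z\<in>X. K s x z * \<phi> s z)) absolutely_integrable_on {0..T}"
proof -
  have "continuous_on {0..T} (\<lambda>t. l2norm X (\<phi> t))"
    unfolding L2_set_def by (intro continuous_intros continuous_amplitude)
  then have "bounded ((\<lambda>t. l2norm X (\<phi> t)) ` {0..T})"
    by (intro compact_imp_bounded compact_continuous_image) auto
  then obtain C where C: "\<And>t. t \<in> {0..T} \<Longrightarrow> l2norm X (\<phi> t) \<le> C"
    unfolding bounded_iff by force
  show ?thesis
  proof (rule absolutely_integrable_integrable_bound)
    fix t assume t: "t \<in> {0..T}"
    show "norm (- \<i> * (\<Sum>z\<in>X. K t x z * \<phi> t z)) \<le> \<nu> t * C"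
      using velocity_bound[OF t assms] mult_left_mono[OF C[OF t] rate_nonneg[OF t]] by linarith
  next
    show "(\<lambda>t. \<nu> t * C) integrable_on {0..T}"
      by (rule integrable_on_mult_left[OF rate_integrable])
  qed (rule velocity_integrable[OF assms])
qed

lemma weight_has_integral:
  assumes "0 \<le> a" "a \<le> b" "b \<le> T"
  shows "((\<lambda>s. Im (sesq X (\<lambda>x y. of_real (n x - n y) * K s x y) (\<phi> s) (\<phi> s)))
    has_integral weight n b - weight n a) {a..b}"
proof -
  let ?f = "\<lambda>x s. - \<i> * (\<Sum>z\<in>X. K s x z * \<phi> s z)"
  have "((\<lambda>s. n x * (2 * Re (cnj (\<phi> s x) * ?f x s))) has_integral
      n x * ((cmod (\<phi> b x))\<^sup>2 - (cmod (\<phi> a x))\<^sup>2)) {a..b}" if x: "x \<in> X" for x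
  proof (rule has_integral_mult_right, rule norm_square_has_integral[OF assms(2)])
    show "?f x absolutely_integrable_on {a..b}"
      by (rule absolutely_integrable_on_subinterval[OF velocity_absolutely_integrable[OF x]])
        (use assms in auto)
    fix t assume t: "t \<in> {a..b}"
    have i: "?f x integrable_on {0..t}"
      by (rule integrable_on_subinterval[OF velocity_integrable[OF x]]) (use assms t in auto)
    have "integral {0..a} (?f x) + integral {a..t} (?f x) = integral {0..t} (?f x)"
      using assms t i by (intro Henstock_Kurzweil_Integration.integral_combine) auto
    moreover have "integral {0..a} (?f x) = \<phi> a x - \<phi> 0 x" "integral {0..t} (?f x) = \<phi> t x - \<phi> 0 x"
      by (rule integral_unique, rule evolves[OF _ x], use assms t in simp)+
    ultimately have "integral {a..t} (?f x) = \<phi> t x - \<phi> a x" by (simp add: algebra_simps)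
    moreover have "?f x integrable_on {a..t}"
      by (rule integrable_on_subinterval[OF i]) (use assms t in auto)
    ultimately show "(?f x has_integral \<phi> t x - \<phi> a x) {a..t}"
      by (metis integrable_integral)
  qed
  then have "((\<lambda>s. \<Sum>x\<in>X. n x * (2 * Re (cnj (\<phi> s x) * ?f x s))) has_integral
      (\<Sum>x\<in>X. n x * ((cmod (\<phi> b x))\<^sup>2 - (cmod (\<phi> a x))\<^sup>2))) {a..b}"
    by (rule has_integral_sum[OF fin])
  moreover have "(\<Sum>x\<in>X. n x * ((cmod (\<phi> b x))\<^sup>2 - (cmod (\<phi> a x))\<^sup>2)) = weight n b - weight n a"
    by (simp add: weight_def right_diff_distrib sum_subtractf)
  ultimately have int: "((\<lambda>s. \<Sum>x\<in>X. n x * (2 * Re (cnj (\<phi> s x) * ?f x s))) has_integral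
      weight n b - weight n a) {a..b}"
    by (simp only:)
  show ?thesis
    by (rule has_integral_eq[OF _ int], rule sesq_commutator_hermitian, rule hermitian)
      (use assms in auto)
qed

text \<open>A constant grading commutes with everything, so the corresponding weight, the squared
  norm, has rate zero.\<close>

lemma norm_conserved:
  assumes "t \<in> {0..T}"
  shows "l2norm X (\<phi> t) = l2norm X (\<phi> 0)"
proof -
  have "((\<lambda>s. 0) has_integral weight (\<lambda>_. 1) t - weight (\<lambda>_. 1) 0) {0..t}"
    using weight_has_integral[of 0 t "\<lambda>_. 1"] assms by (simp add: sesq_def)
  then have "weight (\<lambda>_. 1) t - weight (\<lambda>_. 1) 0 = 0"
    by (rule has_integral_unique[OF _ has_integral_0])
  then show ?thesis by (simp add: weight_def L2_set_def)
qed

text \<open>The factor \<open>\<kappa>\<close> is left open so that both Bernstein's inequality and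
  the uncertainty relation can supply it.\<close>

lemma weight_diff_le:
  assumes ab: "0 \<le> a" "a \<le> b" "b \<le> T"
    and le: "\<And>s. s \<in> {a..b} \<Longrightarrow>
      cmod (sesq X (\<lambda>x y. of_real (n x - n y) * K s x y) (\<phi> s) (\<phi> s)) \<le> \<kappa> * \<nu> s"
  shows "\<bar>weight n b - weight n a\<bar> \<le> \<kappa> * integral {a..b} \<nu>"
proof -
  note hi = weight_has_integral[OF ab, of n]
  have "\<nu> integrable_on {a..b}"
    by (rule integrable_on_subinterval[OF rate_integrable]) (use ab in auto)
  then have "norm (integral {a..b} (\<lambda>s. Im (sesq X (\<lambda>x y. of_real (n x - n y) * K s x y) (\<phi> s) (\<phi> s))))
      \<le> integral {a..b} (\<lambda>s. \<kappa> * \<nu> s)"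
    using hi le by (intro integral_norm_bound_integral integrable_on_mult_right)
      (auto intro: order_trans[OF abs_Im_le_cmod])
  then show ?thesis unfolding integral_unique[OF hi] by simp
qed

lemma graded_weight_diff_le:
  fixes n :: "'a \<Rightarrow> nat"
  assumes ab: "0 \<le> a" "a \<le> b" "b \<le> T"
    and band: "\<And>s x y. s \<in> {0..T} \<Longrightarrow> x \<in> X \<Longrightarrow> y \<in> X \<Longrightarrow> K s x y \<noteq> 0 \<Longrightarrow> n x \<le> n y + k \<and> n y \<le> n x + k"
  shows "\<bar>weight n b - weight n a\<bar> \<le> real k * (l2norm X (\<phi> 0))\<^sup>2 * integral {a..b} \<nu>"
proof (rule weight_diff_le[OF ab])
  fix s assume "s \<in> {a..b}"
  then have s: "s \<in> {0..T}" using ab by auto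
  show "cmod (sesq X (\<lambda>x y. of_real (real (n x) - real (n y)) * K s x y) (\<phi> s) (\<phi> s))
      \<le> real k * (l2norm X (\<phi> 0))\<^sup>2 * \<nu> s"
    using sesq_commutator_grading_bound[of X "K s" "\<nu> s" n k "\<phi> s", OF bound[OF s] band[OF s]]
    unfolding norm_conserved[OF s] by (simp add: mult_ac)
qed

text \<open>Near the bottom of the grading the variance is small, so the uncertainty relation beats
  Bernstein's inequality on an initial time interval; this gives strictness.\<close>

lemma graded_weight_full_range_less:
  fixes n :: "'a \<Rightarrow> nat"
  assumes band: "\<And>s x y. s \<in> {0..T} \<Longrightarrow> x \<in> X \<Longrightarrow> y \<in> X \<Longrightarrow> K s x y \<noteq> 0 \<Longrightarrow> n x \<le> n y + k \<and> n y \<le> n x + k"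
    and n_le: "\<And>x. x \<in> X \<Longrightarrow> n x \<le> N"
    and unit: "l2norm X (\<phi> 0) = 1"
    and start: "weight n 0 = 0" and final: "weight n T = real N"
    and N: "1 \<le> N" and k: "1 \<le> k"
  shows "real N < real k * integral {0..T} \<nu>"
proof -
  let ?g = "weight n"
  \<comment> \<open>While the mean of \<open>n\<close> is at most \<eta>, its second moment is at
    most \<open>N * \<eta> = 1 / 16\<close>, so the vector obtained by multiplying by
    \<open>n\<close> has norm at most 1/4. The uncertainty relation then gives the rate 1/2, which
    is below \<open>k\<close>.\<close>
  define \<eta> where "\<eta> = 1 / (16 * real N)"
  have \<eta>: "0 < \<eta>" "\<eta> < real N" "real N * \<eta> = 1 / 16"
  proof -
    have "1 \<le> 16 * real N" using N by simp
    then have "\<eta> \<le> 1" unfolding \<eta>_def by simp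
    moreover have "\<eta> \<noteq> 1" using N unfolding \<eta>_def by simp
    ultimately show "\<eta> < real N" using N by simp
  qed (use N in \<open>auto simp: \<eta>_def\<close>)
  \<comment> \<open>The least element of this compact set is the first time the mean reaches \<eta>;
    until then the mean cannot exceed \<eta>, by the intermediate value theorem.\<close>
  define Z where "Z = {t \<in> {0..T}. ?g t = \<eta>}"
  have "Z = {0..T} \<inter> ?g -` {\<eta>}" unfolding Z_def by auto
  then have "closed Z"
    using continuous_closed_preimage[OF continuous_weight, of "{\<eta>}" n] by simp
  moreover have "bounded Z"
    by (rule bounded_subset[OF bounded_closed_interval[of 0 T]]) (auto simp: Z_def)
  ultimately have "compact Z" by (simp add: compact_eq_bounded_closed)
  moreover have "Z \<noteq> {}"
    using IVT'[of ?g 0 \<eta> T] start final \<eta> T_nonneg continuous_weight[of n] unfolding Z_def by auto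
  ultimately obtain r where r: "r \<in> Z" "\<And>t. t \<in> Z \<Longrightarrow> r \<le> t"
    using compact_attains_inf[of Z] by blast
  have rT: "r \<in> {0..T}" and gr: "?g r = \<eta>" using r(1) unfolding Z_def by auto
  have low: "?g s \<le> \<eta>" if s: "s \<in> {0..r}" for s
  proof (rule ccontr)
    assume "\<not> ?g s \<le> \<eta>"
    then obtain t where "0 \<le> t" "t \<le> s" "?g t = \<eta>"
      using IVT'[of ?g 0 \<eta> s] start \<eta> s rT continuous_on_subset[OF continuous_weight[of n], of "{0..s}"]
      by auto
    then have "t \<in> Z" using s rT unfolding Z_def by auto
    then have "s = r" using r(2)[of t] \<open>t \<le> s\<close> s by auto
    then show False using \<open>\<not> ?g s \<le> \<eta>\<close> gr by simp
  qed
  have "\<bar>?g r - ?g 0\<bar> \<le> 1 / 2 * integral {0..r} \<nu>"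
  proof (rule weight_diff_le)
    fix s assume s: "s \<in> {0..r}"
    then have sT: "s \<in> {0..T}" using rT by auto
    define u where "u x = of_nat (n x) * \<phi> s x" for x
    \<comment> \<open>The uncertainty relation: the commutator form is a difference of two forms,
      each containing the vector \<open>u\<close> once, so it is small when \<open>u\<close>
      is.\<close>
    have "sesq X (\<lambda>x y. of_real (real (n x) - real (n y)) * K s x y) (\<phi> s) (\<phi> s)
        = sesq X (K s) u (\<phi> s) - sesq X (K s) (\<phi> s) u"
      unfolding sesq_def u_def by (simp add: sum_subtractf[symmetric] algebra_simps)
    then have "cmod (sesq X (\<lambda>x y. of_real (real (n x) - real (n y)) * K s x y) (\<phi> s) (\<phi> s))
        \<le> cmod (sesq X (K s) u (\<phi> s)) + cmod (sesq X (K s) (\<phi> s) u)"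
      by (simp add: norm_triangle_ineq4)
    also have "\<dots> \<le> 2 * \<nu> s * l2norm X u"
      using bound[OF sT, of u "\<phi> s"] bound[OF sT, of "\<phi> s" u] norm_conserved[OF sT] unit by simp
    also have "l2norm X u \<le> sqrt (real N * \<eta>)"
    proof -
      have "(\<Sum>x\<in>X. (cmod (u x))\<^sup>2) \<le> (\<Sum>x\<in>X. real N * (real (n x) * (cmod (\<phi> s x))\<^sup>2))"
      proof (rule sum_mono)
        fix x assume "x \<in> X"
        then have "real (n x) * (real (n x) * (cmod (\<phi> s x))\<^sup>2) \<le> real N * (real (n x) * (cmod (\<phi> s x))\<^sup>2)"
          using n_le by (intro mult_right_mono) auto
        then show "(cmod (u x))\<^sup>2 \<le> real N * (real (n x) * (cmod (\<phi> s x))\<^sup>2)"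
          by (simp add: u_def norm_mult power_mult_distrib power2_eq_square mult_ac)
      qed
      also have "\<dots> = real N * ?g s" by (simp add: weight_def sum_distrib_left)
      also have "\<dots> \<le> real N * \<eta>" using low[OF s] by (intro mult_left_mono) auto
      finally show ?thesis unfolding L2_set_def by simp
    qed
    also have "sqrt (real N * \<eta>) = 1 / 4"
      unfolding \<eta>(3) by (rule real_sqrt_unique) (auto simp: power2_eq_square)
    finally show "cmod (sesq X (\<lambda>x y. of_real (real (n x) - real (n y)) * K s x y) (\<phi> s) (\<phi> s)) \<le> 1 / 2 * \<nu> s"
      using rate_nonneg[OF sT] by (simp add: mult_left_mono)
  qed (use rT in auto)
  then have early: "\<eta> \<le> 1 / 2 * integral {0..r} \<nu>" using start gr \<eta> by simp
  have "\<bar>?g T - ?g r\<bar> \<le> real k * (l2norm X (\<phi> 0))\<^sup>2 * integral {r..T} \<nu>"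
    by (rule graded_weight_diff_le[OF _ _ _ band]) (use rT in auto)
  then have late: "real N - \<eta> \<le> real k * integral {r..T} \<nu>"
    using final gr unit by simp
  have split: "integral {0..r} \<nu> + integral {r..T} \<nu> = integral {0..T} \<nu>"
    using rT by (intro Henstock_Kurzweil_Integration.integral_combine rate_integrable) auto
  \<comment> \<open>The integral up to \<open>r\<close> is positive because the mean has risen by
    \<eta>, so replacing the rate 1/2 by \<open>k\<close> is a strict loss.\<close>
  have "1 / 2 * integral {0..r} \<nu> < real k * integral {0..r} \<nu>"
    using early \<eta> k by (intro mult_strict_right_mono) auto
  then show ?thesis unfolding split[symmetric] using early late by (simp add: distrib_left)
qed

end

section \<open>Operator norm and tensor powers\<close>

lemma finite_cfg [simp]: "finite (cfg N d)"
  by (simp add: cfg_def finite_PiE)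

lemma constant_cfg: "c < d \<Longrightarrow> (\<lambda>j\<in>{..<N}. c) \<in> cfg N d"
  by (auto simp: cfg_def)

lemma cfg_less: "x \<in> cfg N d \<Longrightarrow> j < N \<Longrightarrow> x j < d"
  by (auto simp: cfg_def)

lemma vnorm_eq_l2norm: "vnorm N d v = l2norm (cfg N d) v"
  by (simp add: vnorm_def L2_set_def)

lemma opnorm_set_nonempty:
  assumes "1 \<le> d"
  shows "{vnorm N d (apply_op N d A v) |v. vnorm N d v = 1} \<noteq> {}"
proof -
  let ?x = "\<lambda>j\<in>{..<N}. 0 :: nat"
  have "(\<Sum>y\<in>cfg N d. (cmod (idop ?x y))\<^sup>2) = (\<Sum>y\<in>cfg N d. if y = ?x then 1 else 0)"
    by (intro sum.cong) (auto simp: idop_def)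
  then have "vnorm N d (idop ?x) = 1"
    using constant_cfg[of 0 d N] assms by (simp add: vnorm_def)
  then show ?thesis by blast
qed

lemma cmod_le_vnorm: "x \<in> cfg N d \<Longrightarrow> cmod (v x) \<le> vnorm N d v"
  unfolding vnorm_eq_l2norm by (intro order_trans[OF _ member_le_L2_set]) auto

text \<open>A real \<open>Sup\<close> is meaningful only for a nonempty set that is bounded above.
  The crude bound by the absolute row sums suffices, since the components of a unit vector have
  modulus at most one.\<close>

lemma opnorm_set_bdd: "bdd_above {vnorm N d (apply_op N d A v) |v. vnorm N d v = 1}"
proof (rule bdd_aboveI)
  fix r assume "r \<in> {vnorm N d (apply_op N d A v) |v. vnorm N d v = 1}"
  then obtain v where r: "r = vnorm N d (apply_op N d A v)" and v: "vnorm N d v = 1" by blast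
  show "r \<le> L2_set (\<lambda>x. \<Sum>y\<in>cfg N d. cmod (A x y)) (cfg N d)"
    unfolding r vnorm_eq_l2norm
  proof (rule L2_set_mono)
    fix x
    have "cmod (A x y) * cmod (v y) \<le> cmod (A x y)" if "y \<in> cfg N d" for y
      using cmod_le_vnorm[OF that, of v] v by (simp add: mult_left_le)
    then show "cmod (apply_op N d A v x) \<le> (\<Sum>y\<in>cfg N d. cmod (A x y))"
      unfolding apply_op_def by (intro sum_norm_le) (simp add: norm_mult)
  qed simp
qed

lemma opnorm_nonneg:
  assumes "1 \<le> d"
  shows "0 \<le> opnorm N d A"
proof -
  obtain r where r: "r \<in> {vnorm N d (apply_op N d A v) |v. vnorm N d v = 1}"
    using opnorm_set_nonempty[OF assms] by blast
  then have "0 \<le> r" by (auto simp: vnorm_eq_l2norm)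
  then show ?thesis unfolding opnorm_def using cSup_upper[OF r opnorm_set_bdd] by linarith
qed

lemma opnorm_le:
  assumes "1 \<le> d" "\<And>v. vnorm N d v = 1 \<Longrightarrow> vnorm N d (apply_op N d A v) \<le> c"
  shows "opnorm N d A \<le> c"
  unfolding opnorm_def by (rule cSup_least[OF opnorm_set_nonempty[OF assms(1)]]) (use assms(2) in blast)

lemma vnorm_apply_op_le: "vnorm N d (apply_op N d A v) \<le> opnorm N d A * vnorm N d v"
proof (cases "vnorm N d v = 0")
  case True
  then have "v x = 0" if "x \<in> cfg N d" for x
    using cmod_le_vnorm[OF that, of v] by simp
  then have "apply_op N d A v x = 0" for x
    unfolding apply_op_def by simp
  then show ?thesis using True by (simp add: vnorm_def)
next
  case False
  define r where "r = vnorm N d v"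
  have r: "0 < r" using False unfolding r_def vnorm_eq_l2norm by (simp add: order_less_le)
  define u where "u x = v x / of_real r" for x
  have "vnorm N d u = vnorm N d v / r"
    unfolding u_def vnorm_eq_l2norm norm_divide
    using L2_set_right_distrib[of "1 / r" "\<lambda>x. cmod (v x)" "cfg N d"] r by simp
  then have "vnorm N d u = 1" using r unfolding r_def by simp
  then have "vnorm N d (apply_op N d A u) \<le> opnorm N d A"
    unfolding opnorm_def by (intro cSup_upper opnorm_set_bdd) blast
  moreover have "apply_op N d A u x = apply_op N d A v x / of_real r" for x
    unfolding apply_op_def u_def by (simp add: sum_divide_distrib)
  then have "vnorm N d (apply_op N d A u) = vnorm N d (apply_op N d A v) / r"
    unfolding vnorm_eq_l2norm
    using L2_set_right_distrib[of "1 / r" "\<lambda>x. cmod (apply_op N d A v x)" "cfg N d"] r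
    by (simp add: norm_divide)
  ultimately show ?thesis using r unfolding r_def by (simp add: field_simps)
qed

lemma sesq_apply_op: "sesq (cfg N d) A u v = (\<Sum>x\<in>cfg N d. cnj (u x) * apply_op N d A v x)"
  unfolding sesq_def apply_op_def by (simp add: sum_distrib_left mult_ac)

lemma sesq_le_opnorm:
  "cmod (sesq (cfg N d) A u v) \<le> opnorm N d A * l2norm (cfg N d) u * l2norm (cfg N d) v"
proof -
  have "cmod (sesq (cfg N d) A u v) \<le> (\<Sum>x\<in>cfg N d. \<bar>cmod (u x)\<bar> * \<bar>cmod (apply_op N d A v x)\<bar>)"
    unfolding sesq_apply_op by (intro sum_norm_le) (simp add: norm_mult)
  also have "\<dots> \<le> l2norm (cfg N d) u * l2norm (cfg N d) (apply_op N d A v)"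
    by (rule L2_set_mult_ineq)
  also have "\<dots> \<le> l2norm (cfg N d) u * (opnorm N d A * l2norm (cfg N d) v)"
    using vnorm_apply_op_le[of N d A v] unfolding vnorm_eq_l2norm by (intro mult_left_mono) auto
  finally show ?thesis by (simp add: mult_ac)
qed

lemma apply_op_mmul: "apply_op N d (mmul N d A B) v = apply_op N d A (apply_op N d B v)"
proof
  fix x
  have "apply_op N d (mmul N d A B) v x = (\<Sum>y\<in>cfg N d. \<Sum>z\<in>cfg N d. A x z * B z y * v y)"
    by (simp add: apply_op_def mmul_def sum_distrib_right)
  also have "\<dots> = (\<Sum>z\<in>cfg N d. \<Sum>y\<in>cfg N d. A x z * B z y * v y)"
    by (rule sum.swap)
  also have "\<dots> = apply_op N d A (apply_op N d B v) x"
    by (simp add: apply_op_def sum_distrib_left mult_ac)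
  finally show "apply_op N d (mmul N d A B) v x = apply_op N d A (apply_op N d B v) x" .
qed

lemma mmul_eq_apply_op: "mmul N d A B x y = apply_op N d A (\<lambda>z. B z y) x"
  by (simp add: mmul_def apply_op_def)

lemma mmul_assoc: "mmul N d (mmul N d A B) C = mmul N d A (mmul N d B C)"
  by (intro ext) (simp add: mmul_eq_apply_op apply_op_mmul)

lemma apply_op_cong:
  "(\<And>z. z \<in> cfg N d \<Longrightarrow> A x z = B x z) \<Longrightarrow> (\<And>z. z \<in> cfg N d \<Longrightarrow> u z = v z) \<Longrightarrow>
    apply_op N d A u x = apply_op N d B v x"
  by (simp add: apply_op_def)

lemma apply_op_idop: "x \<in> cfg N d \<Longrightarrow> apply_op N d idop v x = v x"
proof -
  assume x: "x \<in> cfg N d"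
  have "apply_op N d idop v x = (\<Sum>y\<in>cfg N d. if y = x then v y else 0)"
    unfolding apply_op_def by (intro sum.cong) (auto simp: idop_def)
  then show ?thesis using x by simp
qed

lemma adj_mmul: "adj (mmul N d A B) = mmul N d (adj B) (adj A)"
  by (intro ext) (simp add: adj_def mmul_def mult_ac)

section \<open>Tensor powers and product distributions on configurations\<close>

lemma sum_cfg_prod: "(\<Sum>x\<in>cfg N d. \<Prod>j<N. f j (x j)) = (\<Prod>j<N. \<Sum>c<d. f j c)"
  for f :: "nat \<Rightarrow> nat \<Rightarrow> 'b::comm_semiring_1"
  unfolding cfg_def by (subst prod_sum_PiE) auto

lemma mmul_tpow:
  "mmul N d (tpow N A) (tpow N B) = tpow N (\<lambda>a b. \<Sum>c<d. A a c * B c b)"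
  by (intro ext) (simp add: mmul_def tpow_def prod.distrib[symmetric]
      sum_cfg_prod[where f="\<lambda>j c. A (_ j) c * B c (_ j)"])

lemma trace_tpow: "(\<Sum>x\<in>cfg N d. tpow N A x x) = (\<Sum>c<d. A c c) ^ N"
  unfolding tpow_def by (simp add: sum_cfg_prod[where f="\<lambda>_ c. A c c"])

lemma tpow_one:
  assumes "x \<in> cfg N d" "y \<in> cfg N d" "\<And>a b. a < d \<Longrightarrow> b < d \<Longrightarrow> A a b = (if a = b then 1 else 0)"
  shows "tpow N A x y = idop x y"
proof (cases "x = y")
  case True
  then show ?thesis using assms(3) cfg_less[OF assms(1)] by (simp add: tpow_def idop_def)
next
  case False
  \<comment> \<open>Configurations are extensional: outside \<open>{..<N}\<close> they all take the
    same default value, so distinct ones differ at some battery.\<close>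
  then obtain j where "j < N" "x j \<noteq> y j"
    using assms(1,2) unfolding cfg_def by (metis PiE_ext lessThan_iff)
  then have "tpow N A x y = 0"
    using assms(3) cfg_less[OF assms(1)] cfg_less[OF assms(2)] unfolding tpow_def
    by (intro prod_zero) (auto intro!: bexI[of _ j])
  then show ?thesis using False by (simp add: idop_def)
qed

definition level_count :: "nat \<Rightarrow> nat \<Rightarrow> (nat \<Rightarrow> nat) \<Rightarrow> nat" where
  "level_count N l x = card {j. j < N \<and> x j = l}"

lemma level_count_le: "level_count N l x \<le> N"
  unfolding level_count_def using card_mono[of "{..<N}" "{j. j < N \<and> x j = l}"] by auto

text \<open>At worst every battery in \<open>S\<close> enters or leaves the level. This is how the
  interaction order becomes a bandwidth.\<close>

lemma level_count_le_add:
  assumes "\<And>j. j < N \<Longrightarrow> j \<notin> S \<Longrightarrow> x j = y j" "S \<subseteq> {..<N}" "card S \<le> k"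
  shows "level_count N l x \<le> level_count N l y + k"
proof -
  have "finite S" using assms(2) finite_subset by blast
  then have "level_count N l x \<le> card ({j. j < N \<and> y j = l} \<union> S)"
    unfolding level_count_def using assms(1) by (intro card_mono) auto
  also have "\<dots> \<le> level_count N l y + card S"
    unfolding level_count_def by (rule card_Un_le)
  finally show ?thesis using assms(3) by linarith
qed

text \<open>Linearity of expectation over the batteries: in a product distribution the marginal of
  each battery is \<open>q\<close>. The weights are complex because they will be diagonal entries of
  a rotated density matrix.\<close>

lemma expected_level_count:
  fixes q :: "nat \<Rightarrow> complex"
  assumes "l < d" "(\<Sum>c<d. q c) = 1"
  shows "(\<Sum>x\<in>cfg N d. of_nat (level_count N l x) * (\<Prod>j<N. q (x j))) = of_nat N * q l"
proof -
  have count: "of_nat (level_count N l x) = (\<Sum>i<N. if x i = l then 1 else 0 :: complex)" for x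
  proof -
    have "{j. j < N \<and> x j = l} = {..<N} \<inter> {j. x j = l}" by auto
    then show ?thesis by (simp add: level_count_def sum.If_cases)
  qed
  have "(\<Sum>x\<in>cfg N d. of_nat (level_count N l x) * (\<Prod>j<N. q (x j)))
      = (\<Sum>i<N. \<Sum>x\<in>cfg N d. (if x i = l then 1 else 0) * (\<Prod>j<N. q (x j)))"
    by (subst sum.swap) (simp add: count sum_distrib_right)
  also have "\<dots> = (\<Sum>i<N. q l)"
  proof (rule sum.cong[OF refl])
    fix i assume i: "i \<in> {..<N}"
    have split: "(\<Prod>j<N. F j) = F i * (\<Prod>j\<in>{..<N} - {i}. F j)" for F :: "nat \<Rightarrow> complex"
      using i by (intro prod.remove) auto
    have "(if x i = l then 1 else 0) * (\<Prod>j<N. q (x j))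
        = (\<Prod>j<N. if j = i \<and> x j \<noteq> l then 0 else q (x j))" for x
      by (simp add: split)
    then have "(\<Sum>x\<in>cfg N d. (if x i = l then 1 else 0) * (\<Prod>j<N. q (x j)))
        = (\<Prod>j<N. \<Sum>c<d. if j = i \<and> c \<noteq> l then 0 else q c)"
      by (simp only: sum_cfg_prod[where f="\<lambda>j c. if j = i \<and> c \<noteq> l then 0 else q c"])
    also have "\<dots> = (\<Sum>c<d. if c \<noteq> l then 0 else q c)"
      using assms(2) by (simp add: split)
    also have "\<dots> = (\<Sum>c<d. if c = l then q c else 0)"
      by (intro sum.cong) auto
    also have "\<dots> = q l" using assms(1) by simp
    finally show "(\<Sum>x\<in>cfg N d. (if x i = l then 1 else 0) * (\<Prod>j<N. q (x j))) = q l" .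
  qed
  finally show ?thesis by simp
qed

section \<open>Gram decompositions and local basis changes\<close>

text \<open>An outer-product Cholesky factorisation, which avoids diagonalising the matrix. The last
  column is split off as a rank-one term, and the Schur complement that remains is again positive
  semidefinite.\<close>

lemma psd_gram_decomposition:
  fixes M :: "nat \<Rightarrow> nat \<Rightarrow> complex"
  assumes "\<And>i j. i < d \<Longrightarrow> j < d \<Longrightarrow> M i j = cnj (M j i)"
    and "\<And>v :: nat \<Rightarrow> complex. 0 \<le> Re (\<Sum>i<d. \<Sum>j<d. cnj (v i) * M i j * v j)"
  shows "\<exists>V :: nat \<Rightarrow> nat \<Rightarrow> complex. \<forall>a<d. \<forall>b<d. M a b = (\<Sum>l<d. V l a * cnj (V l b))"
  using assms
proof (induction d arbitrary: M)
  case 0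
  then show ?case by simp
next
  case (Suc d)
  have herm: "cnj (M i j) = M j i" if "i \<le> d" "j \<le> d" for i j
    using Suc.prems(1)[of j i] that by simp
  define m where "m = Re (M d d)"
  have Mdd: "M d d = of_real m"
    using herm[of d d] unfolding m_def by (simp add: complex_eq_iff)
  define form where "form u = (\<Sum>i<d. \<Sum>j<d. cnj (u i) * M i j * u j)" for u
  have expand: "(\<Sum>i<Suc d. \<Sum>j<Suc d. cnj (v i) * M i j * v j)
      = form v + (\<Sum>i<d. cnj (v i) * M i d) * v d + cnj (v d) * (\<Sum>j<d. M d j * v j)
        + cnj (v d) * of_real m * v d" for v
    by (simp add: form_def sum.distrib sum_distrib_right sum_distrib_left Mdd mult_ac)
  have cnj_row: "cnj (\<Sum>j<d. M d j * v j) = (\<Sum>i<d. cnj (v i) * M i d)" for v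
    unfolding cnj_sum by (intro sum.cong refl) (simp add: herm)
  have m_nonneg: "0 \<le> m"
  proof -
    have "0 \<le> Re (\<Sum>i<Suc d. \<Sum>j<Suc d. cnj ((if i = d then 1 else 0) :: complex) * M i j * (if j = d then 1 else 0))"
      by (rule Suc.prems(2))
    then show ?thesis unfolding expand form_def by simp
  qed
  have zero_row: "M a d = 0" if a: "a < d" and m: "m = 0" for a
  proof (rule ccontr)
    assume nz: "M a d \<noteq> 0"
    \<comment> \<open>With a zero corner the form is affine in the last coordinate; \<open>r\<close>
      is chosen to make its value -1, contradicting positivity.\<close>
    define r where "r = (Re (M a a) + 1) / (2 * (cmod (M a d))\<^sup>2)"
    define v where "v i = (if i = a then 1 else if i = d then - of_real r * cnj (M a d) else 0)" for i
    have sums: "form v = M a a" "(\<Sum>i<d. cnj (v i) * M i d) = M a d"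
    proof -
      have "(\<Sum>i<d. cnj (v i) * F i) = F a" for F
      proof -
        have "(\<Sum>i<d. cnj (v i) * F i) = (\<Sum>i<d. if i = a then F i else 0)"
          by (intro sum.cong) (auto simp: v_def)
        then show ?thesis using a by simp
      qed
      moreover have "(\<Sum>j<d. F j * v j) = F a" for F
      proof -
        have "(\<Sum>j<d. F j * v j) = (\<Sum>j<d. if j = a then F j else 0)"
          by (intro sum.cong) (auto simp: v_def)
        then show ?thesis using a by simp
      qed
      moreover have "form v = (\<Sum>i<d. cnj (v i) * (\<Sum>j<d. M i j * v j))"
        unfolding form_def by (simp add: sum_distrib_left mult_ac)
      ultimately show "form v = M a a" "(\<Sum>i<d. cnj (v i) * M i d) = M a d" by simp_all
    qed
    have row: "(\<Sum>j<d. M d j * v j) = cnj (M a d)"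
      using arg_cong[OF cnj_row[of v], of cnj] unfolding sums by simp
    have vd: "v d = - of_real r * cnj (M a d)" using a by (simp add: v_def)
    have "0 \<le> Re (\<Sum>i<Suc d. \<Sum>j<Suc d. cnj (v i) * M i j * v j)" by (rule Suc.prems(2))
    also have "\<dots> = Re (M a a) - 2 * r * (cmod (M a d))\<^sup>2"
      unfolding expand sums row vd m cmod_power2 by (simp add: power2_eq_square algebra_simps)
    also have "\<dots> = - 1" using nz unfolding r_def by (simp add: field_simps)
    finally show False by simp
  qed
  define s where "s = complex_of_real (sqrt m)"
  have ss: "s * s = of_real m" "cnj s = s"
    using m_nonneg by (simp_all add: s_def of_real_mult[symmetric] del: of_real_mult)
  have s0: "s = 0 \<longleftrightarrow> m = 0" by (simp add: s_def)
  \<comment> \<open>If \<open>m = 0\<close>, division by \<open>s = 0\<close> yields 0 and nothing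
    is subtracted. This is consistent because the last column then vanishes by
    \<open>zero_row\<close>.\<close>
  define M' where "M' a b = M a b - (M a d / s) * cnj (M b d / s)" for a b
  have M'_eq: "M' a b = M a b - M a d * M d b / of_real m" if "a < d" "b < d" for a b
    using that unfolding M'_def by (simp add: herm ss)
  have "\<exists>V :: nat \<Rightarrow> nat \<Rightarrow> complex. \<forall>a<d. \<forall>b<d. M' a b = (\<Sum>l<d. V l a * cnj (V l b))"
  proof (rule Suc.IH)
    show "M' i j = cnj (M' j i)" if "i < d" "j < d" for i j
      using that unfolding M'_def by (simp add: herm mult_ac)
    fix v :: "nat \<Rightarrow> complex"
    define c where "c = (\<Sum>j<d. M d j * v j)"
    \<comment> \<open>Completing the square: for \<open>m > 0\<close> this last coordinate minimises
      the full form over extensions of \<open>v\<close>, and the minimum is the form of the Schur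
      complement. For \<open>m = 0\<close> it is 0.\<close>
    define u where "u = v(d := - c / of_real m)"
    have u: "form u = form v" "(\<Sum>j<d. M d j * u j) = c" "(\<Sum>i<d. cnj (u i) * M i d) = cnj c"
      "u d = - c / of_real m"
    proof -
      have ui: "u i = v i" if "i < d" for i using that by (simp add: u_def)
      show "form u = form v" "(\<Sum>j<d. M d j * u j) = c" by (simp_all add: form_def c_def ui)
      then show "(\<Sum>i<d. cnj (u i) * M i d) = cnj c" by (metis cnj_row)
    qed (simp add: u_def)
    have "(\<Sum>i<d. \<Sum>j<d. cnj (v i) * M' i j * v j)
        = form v - (\<Sum>i<d. \<Sum>j<d. (cnj (v i) * M i d) * (M d j * v j)) / of_real m"
      unfolding form_def sum_divide_distrib sum_subtractf[symmetric]
      by (intro sum.cong refl) (simp add: M'_eq algebra_simps)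
    also have "(\<Sum>i<d. \<Sum>j<d. (cnj (v i) * M i d) * (M d j * v j)) = cnj c * c"
      unfolding c_def cnj_row by (simp add: sum_product)
    also have "form v - cnj c * c / of_real m = (\<Sum>i<Suc d. \<Sum>j<Suc d. cnj (u i) * M i j * u j)"
      unfolding expand u by (cases "m = 0") (simp_all add: field_simps)
    finally show "0 \<le> Re (\<Sum>i<d. \<Sum>j<d. cnj (v i) * M' i j * v j)"
      using Suc.prems(2)[of u] by simp
  qed
  then obtain V where V: "\<And>a b. a < d \<Longrightarrow> b < d \<Longrightarrow> M' a b = (\<Sum>l<d. V l a * cnj (V l b))"
    by blast
  define W where "W l a = (if l = d then M a d / s else if a = d then 0 else V l a)" for l a
  have last: "M a d = (M a d / s) * cnj (M d d / s)" if "a \<le> d" for a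
  proof (cases "m = 0")
    case True
    then show ?thesis using that zero_row[of a] Mdd s0 by (cases "a = d") auto
  next
    case False
    then have "cnj (M d d / s) = s" using s0 ss Mdd by (simp add: field_simps)
    then show ?thesis using False s0 by simp
  qed
  have "M a b = (\<Sum>l<Suc d. W l a * cnj (W l b))" if ab: "a \<le> d" "b \<le> d" for a b
  proof -
    consider "a < d" "b < d" | "b = d" | "a = d" using ab by linarith
    then show ?thesis
    proof cases
      case 1
      then have "(\<Sum>l<d. W l a * cnj (W l b)) = M' a b"
        unfolding V[OF 1] by (intro sum.cong) (auto simp: W_def)
      then show ?thesis by (simp add: W_def M'_def)
    next
      case 2
      then have "(\<Sum>l<d. W l a * cnj (W l b)) = 0"
        by (intro sum.neutral) (auto simp: W_def)
      then show ?thesis using last[OF ab(1)] 2 by (simp add: W_def)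
    next
      case 3
      then have "(\<Sum>l<d. W l a * cnj (W l b)) = 0"
        by (intro sum.neutral) (auto simp: W_def)
      then show ?thesis
        using arg_cong[OF last[OF ab(2)], of cnj] herm[OF ab(2), of d] 3 by (simp add: W_def mult_ac)
    qed
  qed
  then show ?case by (intro exI[of _ W]) auto
qed

lemma tpow_gram_decomposition:
  assumes "\<And>a b. a < d \<Longrightarrow> b < d \<Longrightarrow> \<rho> a b = (\<Sum>l<d. V l a * cnj (V l b))"
    and "x \<in> cfg N d" "y \<in> cfg N d"
  shows "tpow N \<rho> x y = (\<Sum>L\<in>cfg N d. (\<Prod>j<N. V (L j) (x j)) * cnj (\<Prod>j<N. V (L j) (y j)))"
proof -
  have "tpow N \<rho> x y = (\<Prod>j<N. \<Sum>l<d. V l (x j) * cnj (V l (y j)))"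
    unfolding tpow_def using assms(1) cfg_less[OF assms(2)] cfg_less[OF assms(3)]
    by (intro prod.cong) auto
  also have "\<dots> = (\<Sum>L\<in>cfg N d. \<Prod>j<N. V (L j) (x j) * cnj (V (L j) (y j)))"
    by (simp add: sum_cfg_prod[where f="\<lambda>j l. V l (x j) * cnj (V l (y j))"])
  finally show ?thesis by (simp add: prod.distrib)
qed

section \<open>Conjugation by tensor powers of a one-battery involution\<close>

lemma sum_cfg_split:
  assumes "j < N"
  shows "(\<Sum>z\<in>cfg N d. F z) = (\<Sum>g\<in>PiE ({..<N} - {j}) (\<lambda>_. {..<d}). \<Sum>c<d. F (g(j := c)))"
proof -
  let ?R = "PiE ({..<N} - {j}) (\<lambda>_. {..<d})"
  have "cfg N d = PiE (insert j ({..<N} - {j})) (\<lambda>_. {..<d})"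
    unfolding cfg_def using assms by (simp add: insert_absorb)
  also have "\<dots> = (\<lambda>(y, g). g(j := y)) ` ({..<d} \<times> ?R)" by (rule PiE_insert_eq)
  finally have cfg: "cfg N d = (\<lambda>(y, g). g(j := y)) ` ({..<d} \<times> ?R)" .
  have "(\<Sum>z\<in>cfg N d. F z) = (\<Sum>(c, g)\<in>{..<d} \<times> ?R. F (g(j := c)))"
    unfolding cfg
    by (subst sum.reindex[OF inj_combinator[of j "{..<N} - {j}" "\<lambda>_. {..<d}"]])
      (auto simp: case_prod_unfold)
  also have "\<dots> = (\<Sum>g\<in>?R. \<Sum>c<d. F (g(j := c)))"
    by (subst sum.cartesian_product[symmetric]) (rule sum.swap)
  finally show ?thesis .
qed

text \<open>Hermitian unitaries with square one. Conjugation by such a matrix needs no separate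
  adjoint or inverse, and the identity, the phase-twisted Hadamard gate and the level swap used
  below are all of this kind.\<close>

locale involution =
  fixes d :: nat and w :: "nat \<Rightarrow> nat \<Rightarrow> complex"
  assumes w_hermitian: "\<And>a b. a < d \<Longrightarrow> b < d \<Longrightarrow> cnj (w a b) = w b a"
    and w_square: "\<And>a b. a < d \<Longrightarrow> b < d \<Longrightarrow> (\<Sum>c<d. w a c * w c b) = (if a = b then 1 else 0)"
begin

definition rotate1 :: "(nat \<Rightarrow> nat \<Rightarrow> complex) \<Rightarrow> nat \<Rightarrow> nat \<Rightarrow> complex" where
  "rotate1 A a b = (\<Sum>c<d. (\<Sum>e<d. w a e * A e c) * w c b)"

definition rotate :: "nat \<Rightarrow> op \<Rightarrow> op" where
  "rotate N A = mmul N d (mmul N d (tpow N w) A) (tpow N w)"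

lemma rotate_tpow: "rotate N (tpow N A) = tpow N (rotate1 A)"
  by (simp add: rotate_def rotate1_def[abs_def] mmul_tpow)

lemma trace_rotate1: "(\<Sum>a<d. rotate1 A a a) = (\<Sum>a<d. A a a)"
proof -
  have "(\<Sum>a<d. rotate1 A a a) = (\<Sum>a<d. \<Sum>c<d. \<Sum>e<d. w a e * A e c * w c a)"
    by (simp add: rotate1_def sum_distrib_right)
  also have "\<dots> = (\<Sum>c<d. \<Sum>a<d. \<Sum>e<d. w a e * A e c * w c a)"
    by (rule sum.swap)
  also have "\<dots> = (\<Sum>c<d. \<Sum>e<d. \<Sum>a<d. w a e * A e c * w c a)"
    by (intro sum.cong refl sum.swap)
  also have "\<dots> = (\<Sum>c<d. \<Sum>e<d. if e = c then A e c else 0)"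
  proof (intro sum.cong refl)
    fix c e assume "c \<in> {..<d}" "e \<in> {..<d}"
    then have "(\<Sum>a<d. w c a * w a e) = (if c = e then 1 else 0)" by (intro w_square) auto
    moreover have "(\<Sum>a<d. w a e * A e c * w c a) = A e c * (\<Sum>a<d. w c a * w a e)"
      by (simp add: sum_distrib_left mult_ac)
    ultimately show "(\<Sum>a<d. w a e * A e c * w c a) = (if e = c then A e c else 0)" by simp
  qed
  finally show ?thesis by simp
qed

lemma tpow_w_hermitian:
  assumes "x \<in> cfg N d" "y \<in> cfg N d"
  shows "cnj (tpow N w x y) = tpow N w y x"
  unfolding tpow_def cnj_prod using assms by (intro prod.cong refl w_hermitian) (auto dest: cfg_less)

lemma tpow_w_apply_twice:
  assumes "x \<in> cfg N d"
  shows "apply_op N d (tpow N w) (apply_op N d (tpow N w) v) x = v x"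
proof -
  have "apply_op N d (mmul N d (tpow N w) (tpow N w)) v x = apply_op N d idop v x"
    unfolding mmul_tpow by (rule apply_op_cong) (use tpow_one assms w_square in auto)
  then show ?thesis using apply_op_idop[OF assms] by (simp add: apply_op_mmul)
qed

lemma tpow_w_self_adjoint:
  "(\<Sum>x\<in>cfg N d. cnj (u x) * apply_op N d (tpow N w) v x)
    = (\<Sum>x\<in>cfg N d. cnj (apply_op N d (tpow N w) u x) * v x)"
proof -
  have "(\<Sum>x\<in>cfg N d. cnj (u x) * apply_op N d (tpow N w) v x)
      = (\<Sum>y\<in>cfg N d. \<Sum>x\<in>cfg N d. cnj (u x) * tpow N w x y * v y)"
    unfolding apply_op_def by (subst sum.swap) (simp add: sum_distrib_left mult_ac)
  also have "\<dots> = (\<Sum>y\<in>cfg N d. cnj (apply_op N d (tpow N w) u y) * v y)"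
    unfolding apply_op_def cnj_sum sum_distrib_right
    by (intro sum.cong refl) (simp add: tpow_w_hermitian mult_ac)
  finally show ?thesis .
qed

lemma l2norm_tpow_w: "l2norm (cfg N d) (apply_op N d (tpow N w) u) = l2norm (cfg N d) u"
proof -
  have sq: "of_real (\<Sum>x\<in>cfg N d. (cmod (v x))\<^sup>2) = (\<Sum>x\<in>cfg N d. cnj (v x) * v x)" for v
    unfolding of_real_sum complex_norm_square by (simp add: mult.commute)
  have "complex_of_real (\<Sum>x\<in>cfg N d. (cmod (apply_op N d (tpow N w) u x))\<^sup>2)
      = of_real (\<Sum>x\<in>cfg N d. (cmod (u x))\<^sup>2)"
    unfolding sq tpow_w_self_adjoint[symmetric] by (simp add: tpow_w_apply_twice)
  then show ?thesis unfolding L2_set_def of_real_eq_iff by simp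
qed

lemma apply_op_rotate:
  "apply_op N d (rotate N A) v = apply_op N d (tpow N w) (apply_op N d A (apply_op N d (tpow N w) v))"
  by (simp add: rotate_def apply_op_mmul)

text \<open>The rotation is unitary, so moving it onto the two vectors leaves their norms unchanged
  and the operator norm of the unrotated \<open>A\<close> still bounds the form.\<close>

lemma sesq_rotate_le:
  "cmod (sesq (cfg N d) (rotate N A) u v) \<le> opnorm N d A * l2norm (cfg N d) u * l2norm (cfg N d) v"
proof -
  have "sesq (cfg N d) (rotate N A) u v
      = sesq (cfg N d) A (apply_op N d (tpow N w) u) (apply_op N d (tpow N w) v)"
    unfolding sesq_apply_op apply_op_rotate tpow_w_self_adjoint ..
  then show ?thesis
    using sesq_le_opnorm[of N d A "apply_op N d (tpow N w) u" "apply_op N d (tpow N w) v"]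
    by (simp add: l2norm_tpow_w)
qed

lemma rotate_hermitian:
  assumes "hermitian N d A" "x \<in> cfg N d" "y \<in> cfg N d"
  shows "rotate N A x y = cnj (rotate N A y x)"
proof -
  have "cnj (rotate N A y x) = (\<Sum>z\<in>cfg N d. \<Sum>z'\<in>cfg N d. cnj (tpow N w y z' * A z' z * tpow N w z x))"
    by (simp add: rotate_def mmul_def sum_distrib_right)
  also have "\<dots> = (\<Sum>z'\<in>cfg N d. \<Sum>z\<in>cfg N d. cnj (tpow N w y z' * A z' z * tpow N w z x))"
    by (rule sum.swap)
  also have "\<dots> = (\<Sum>z'\<in>cfg N d. \<Sum>z\<in>cfg N d. tpow N w x z * A z z' * tpow N w z' y)"
  proof (intro sum.cong refl)
    fix z z' assume z: "z' \<in> cfg N d" "z \<in> cfg N d"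
    have "A z z' = cnj (A z' z)" using assms(1) z unfolding hermitian_def by blast
    then show "cnj (tpow N w y z' * A z' z * tpow N w z x) = tpow N w x z * A z z' * tpow N w z' y"
      using z assms(2,3) by (simp add: tpow_w_hermitian mult_ac)
  qed
  also have "\<dots> = rotate N A x y"
    by (simp add: rotate_def mmul_def sum_distrib_right)
  finally show ?thesis ..
qed

lemma rotate_sum:
  assumes "\<And>x y. x \<in> cfg N d \<Longrightarrow> y \<in> cfg N d \<Longrightarrow> A x y = (\<Sum>\<mu>\<in>M. h \<mu> x y)"
  shows "rotate N A x y = (\<Sum>\<mu>\<in>M. rotate N (h \<mu>) x y)"
proof -
  have "rotate N A x y = (\<Sum>z'\<in>cfg N d. \<Sum>z\<in>cfg N d. \<Sum>\<mu>\<in>M. tpow N w x z * h \<mu> z z' * tpow N w z' y)"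
    unfolding rotate_def mmul_def sum_distrib_right
    by (intro sum.cong refl) (simp add: assms sum_distrib_left sum_distrib_right)
  also have "\<dots> = (\<Sum>z'\<in>cfg N d. \<Sum>\<mu>\<in>M. \<Sum>z\<in>cfg N d. tpow N w x z * h \<mu> z z' * tpow N w z' y)"
    by (intro sum.cong refl sum.swap)
  also have "\<dots> = (\<Sum>\<mu>\<in>M. \<Sum>z'\<in>cfg N d. \<Sum>z\<in>cfg N d. tpow N w x z * h \<mu> z z' * tpow N w z' y)"
    by (rule sum.swap)
  finally show ?thesis by (simp add: rotate_def mmul_def sum_distrib_right)
qed

text \<open>The operator is the identity on battery \<open>j\<close>, and the rotation acts battery
  by battery. The factor at \<open>j\<close> is therefore \<open>w\<close> times \<open>w\<close>,
  the identity matrix, whose entry at distinct levels vanishes.\<close>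

lemma rotate_local:
  assumes h: "acts_on N d S h" and j: "j < N" "j \<notin> S"
    and xy: "x \<in> cfg N d" "y \<in> cfg N d" "x j \<noteq> y j"
  shows "rotate N h x y = 0"
proof -
  let ?R = "PiE ({..<N} - {j}) (\<lambda>_. {..<d})"
  obtain G where G: "\<And>x y. x \<in> cfg N d \<Longrightarrow> y \<in> cfg N d \<Longrightarrow>
      h x y = (if (\<forall>i\<in>{..<N} - S. x i = y i) then G (restrict x S) (restrict y S) else 0)"
    using h unfolding acts_on_def by blast
  have upd: "g(j := c) \<in> cfg N d" if "g \<in> ?R" "c < d" for g c
    using that j unfolding cfg_def by (auto simp: PiE_iff extensional_def)
  have res: "restrict (g(j := c)) S = restrict (g(j := 0)) S" for g :: "nat \<Rightarrow> nat" and c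
    using j(2) by (auto simp: restrict_def)
  \<comment> \<open>Level 0 is an arbitrary reference value: battery \<open>j\<close> lies outside
    \<open>S\<close>, so \<open>restrict\<close> forgets it.\<close>
  define h0 where "h0 g g' = h (g(j := 0)) (g'(j := 0))" for g g'
  have hR: "h (g(j := c)) (g'(j := c')) = (if c = c' then h0 g g' else 0)"
    if "g \<in> ?R" "g' \<in> ?R" "c < d" "c' < d" for g g' c c'
  proof -
    have "0 < d" using that by simp
    moreover have "(\<forall>i\<in>{..<N} - S. (g(j := c)) i = (g'(j := c')) i)
        \<longleftrightarrow> c = c' \<and> (\<forall>i\<in>{..<N} - S. (g(j := 0)) i = (g'(j := 0)) i)"
      using j by auto
    ultimately show ?thesis
      using that unfolding h0_def by (simp only: G upd res[of _ c] res[of _ c']) auto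
  qed
  define P where "P g = (\<Prod>i\<in>{..<N} - {j}. w (x i) (g i))" for g
  define Q where "Q g = (\<Prod>i\<in>{..<N} - {j}. w (g i) (y i))" for g
  have split: "(\<Prod>i<N. F i) = F j * (\<Prod>i\<in>{..<N} - {j}. F i)" for F :: "nat \<Rightarrow> complex"
    using j by (intro prod.remove) auto
  have PQ: "tpow N w x (g(j := c)) = w (x j) c * P g" "tpow N w (g(j := c)) y = w c (y j) * Q g" for g c
    unfolding tpow_def split P_def Q_def by (auto intro!: prod.cong arg_cong2[where f="(*)"])
  have "rotate N h x y = (\<Sum>g'\<in>?R. \<Sum>c'<d. \<Sum>g\<in>?R. \<Sum>c<d.
      tpow N w x (g(j := c)) * h (g(j := c)) (g'(j := c')) * tpow N w (g'(j := c')) y)"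
    unfolding rotate_def mmul_def sum_cfg_split[OF j(1)] sum_distrib_right ..
  also have "\<dots> = (\<Sum>g'\<in>?R. \<Sum>c'<d. \<Sum>g\<in>?R.
      (w (x j) c' * w c' (y j)) * (P g * h0 g g' * Q g'))"
  proof (intro sum.cong refl)
    fix g' c' g assume "g' \<in> ?R" "c' \<in> {..<d}" "g \<in> ?R"
    then have "(\<Sum>c<d. tpow N w x (g(j := c)) * h (g(j := c)) (g'(j := c')) * tpow N w (g'(j := c')) y)
        = (\<Sum>c<d. if c = c' then (w (x j) c' * w c' (y j)) * (P g * h0 g g' * Q g') else 0)"
      by (intro sum.cong refl) (auto simp: hR PQ)
    then show "(\<Sum>c<d. tpow N w x (g(j := c)) * h (g(j := c)) (g'(j := c')) * tpow N w (g'(j := c')) y)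
        = (w (x j) c' * w c' (y j)) * (P g * h0 g g' * Q g')"
      using \<open>c' \<in> {..<d}\<close> by simp
  qed
  also have "\<dots> = (\<Sum>g'\<in>?R. (\<Sum>c'<d. w (x j) c' * w c' (y j)) *
      (\<Sum>g\<in>?R. P g * h0 g g' * Q g'))"
    by (intro sum.cong refl) (rule sum_product[symmetric])
  also have "(\<Sum>c'<d. w (x j) c' * w c' (y j)) = 0"
    using xy j by (simp add: w_square cfg_less)
  finally show ?thesis by simp
qed

text \<open>A nonzero entry of the sum forces a nonzero entry of some single term, and the support
  of that one term already contains every battery on which \<open>x\<close> and \<open>y\<close>
  differ. Overlaps between supports do not enlarge the bandwidth.\<close>

lemma rotate_local_hamiltonian_band:
  assumes "local_hamiltonian N d k m M h S H T" "t \<in> {0..T}"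
    and xy: "x \<in> cfg N d" "y \<in> cfg N d" and nz: "rotate N (H t) x y \<noteq> 0"
  shows "level_count N l x \<le> level_count N l y + k \<and> level_count N l y \<le> level_count N l x + k"
proof -
  have H: "H t x y = (\<Sum>\<mu>\<in>M. h \<mu> t x y)" if "x \<in> cfg N d" "y \<in> cfg N d" for x y
    using assms(1,2) that unfolding local_hamiltonian_def by blast
  have "rotate N (H t) x y = (\<Sum>\<mu>\<in>M. rotate N (h \<mu> t) x y)"
    by (rule rotate_sum[OF H])
  from nz[unfolded this] obtain \<mu> where \<mu>: "\<mu> \<in> M" "rotate N (h \<mu> t) x y \<noteq> 0"
    by (rule sum.not_neutral_contains_not_neutral)
  have S: "S \<mu> t \<subseteq> {..<N}" "card (S \<mu> t) \<le> k" "acts_on N d (S \<mu> t) (h \<mu> t)"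
    using assms(1,2) \<mu>(1) unfolding local_hamiltonian_def by blast+
  have "x j = y j" if "j < N" "j \<notin> S \<mu> t" for j
    using rotate_local[OF S(3) that xy] \<mu>(2) by blast
  then show ?thesis
    using level_count_le_add[of N "S \<mu> t" x y k l] level_count_le_add[of N "S \<mu> t" y x k l] S
    by simp
qed

end

section \<open>Level populations under local Hamiltonians\<close>

lemma schroedingerD:
  assumes "schroedinger N d H U T" "t \<in> {0..T}" "x \<in> cfg N d" "y \<in> cfg N d"
  shows "((\<lambda>s. - \<i> * (\<Sum>z\<in>cfg N d. H s x z * U s z y)) has_integral (U t x y - idop x y)) {0..t}"
  using assms unfolding schroedinger_def by blast

lemma schroedinger_initial:
  assumes "schroedinger N d H U T" "0 \<le> T" "x \<in> cfg N d" "y \<in> cfg N d"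
  shows "U 0 x y = idop x y"
proof -
  have "((\<lambda>s. - \<i> * (\<Sum>z\<in>cfg N d. H s x z * U s z y)) has_integral (U 0 x y - idop x y)) {0..0}"
    by (rule schroedingerD[OF assms(1) _ assms(3,4)]) (use assms(2) in auto)
  then have "U 0 x y - idop x y = 0"
    by (rule has_integral_unique) (simp add: has_integral_refl)
  then show ?thesis by simp
qed

lemma sum_apply_op_gram:
  "(\<Sum>L\<in>I. apply_op N d A (V L) x * cnj (apply_op N d A (V L) y))
    = mmul N d (mmul N d A (\<lambda>z z'. \<Sum>L\<in>I. V L z * cnj (V L z'))) (adj A) x y"
proof -
  have "(\<Sum>L\<in>I. apply_op N d A (V L) x * cnj (apply_op N d A (V L) y))
      = (\<Sum>L\<in>I. \<Sum>z'\<in>cfg N d. \<Sum>z\<in>cfg N d. A x z * (V L z * cnj (V L z')) * cnj (A y z'))"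
    unfolding apply_op_def cnj_sum by (subst sum.swap) (simp add: sum_product mult_ac)
  also have "\<dots> = (\<Sum>z'\<in>cfg N d. \<Sum>L\<in>I. \<Sum>z\<in>cfg N d. A x z * (V L z * cnj (V L z')) * cnj (A y z'))"
    by (rule sum.swap)
  also have "\<dots> = (\<Sum>z'\<in>cfg N d. \<Sum>z\<in>cfg N d. \<Sum>L\<in>I. A x z * (V L z * cnj (V L z')) * cnj (A y z'))"
    by (intro sum.cong refl sum.swap)
  finally show ?thesis
    by (simp add: mmul_def adj_def sum_distrib_left sum_distrib_right)
qed

context involution
begin

text \<open>The rotation is constant in time and squares to the identity on configurations, so it
  can be inserted between \<open>H\<close> and \<open>U\<close>: the rotated vector obeys the
  equation of the rotated Hamiltonian. The rate stays the norm of \<open>H\<close> itself.\<close>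

lemma evolution_rotate:
  assumes d: "1 \<le> d" and T: "0 \<le> T"
    and herm: "\<forall>t\<in>{0..T}. hermitian N d (H t)"
    and int: "(\<lambda>t. opnorm N d (H t)) integrable_on {0..T}"
    and sch: "schroedinger N d H U T"
  shows "evolution (cfg N d) (\<lambda>t. rotate N (H t)) (\<lambda>t. opnorm N d (H t))
    (\<lambda>t. apply_op N d (tpow N w) (apply_op N d (U t) v)) T"
proof
  let ?W = "tpow N w"
  fix t x assume t: "t \<in> {0..T}" and x: "x \<in> cfg N d"
  have "((\<lambda>s. - \<i> * apply_op N d (H s) (apply_op N d (U s) v) z) has_integral
      apply_op N d (U t) v z - apply_op N d (U 0) v z) {0..t}" if z: "z \<in> cfg N d" for z
  proof -
    have "((\<lambda>s. - \<i> * (mmul N d (H s) (U s) z y) * v y) has_integral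
        (U t z y - U 0 z y) * v y) {0..t}" if y: "y \<in> cfg N d" for y
      using schroedingerD[OF sch t z y] unfolding schroedinger_initial[OF sch T z y] mmul_def
      by (rule has_integral_mult_left)
    then have "((\<lambda>s. \<Sum>y\<in>cfg N d. - \<i> * (mmul N d (H s) (U s) z y) * v y) has_integral
        (\<Sum>y\<in>cfg N d. (U t z y - U 0 z y) * v y)) {0..t}"
      by (intro has_integral_sum) auto
    moreover have "(\<Sum>y\<in>cfg N d. - \<i> * (mmul N d (H s) (U s) z y) * v y)
        = - \<i> * apply_op N d (H s) (apply_op N d (U s) v) z" for s
      unfolding apply_op_mmul[symmetric] by (simp add: apply_op_def sum_distrib_left mult_ac sum_negf)
    moreover have "(\<Sum>y\<in>cfg N d. (U t z y - U 0 z y) * v y)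
        = apply_op N d (U t) v z - apply_op N d (U 0) v z"
      by (simp add: apply_op_def sum_subtractf algebra_simps)
    ultimately show ?thesis by (simp only:)
  qed
  then have "((\<lambda>s. \<Sum>z\<in>cfg N d. ?W x z * (- \<i> * apply_op N d (H s) (apply_op N d (U s) v) z)) has_integral
      (\<Sum>z\<in>cfg N d. ?W x z * (apply_op N d (U t) v z - apply_op N d (U 0) v z))) {0..t}"
    by (intro has_integral_sum has_integral_mult_right) auto
  moreover have "(\<Sum>z\<in>cfg N d. ?W x z * (- \<i> * apply_op N d (H s) (apply_op N d (U s) v) z))
      = - \<i> * (\<Sum>z\<in>cfg N d. rotate N (H s) x z * apply_op N d ?W (apply_op N d (U s) v) z)" for s
  proof -
    have "(\<Sum>z\<in>cfg N d. rotate N (H s) x z * apply_op N d ?W (apply_op N d (U s) v) z)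
        = apply_op N d (rotate N (H s)) (apply_op N d ?W (apply_op N d (U s) v)) x"
      by (simp add: apply_op_def)
    also have "\<dots> = apply_op N d ?W (apply_op N d (H s) (apply_op N d (U s) v)) x"
      unfolding apply_op_rotate
      by (rule apply_op_cong[OF refl], rule apply_op_cong[OF refl], rule tpow_w_apply_twice)
    finally show ?thesis
      by (simp add: apply_op_def[of N d ?W] sum_distrib_left mult_ac sum_negf)
  qed
  moreover have "(\<Sum>z\<in>cfg N d. ?W x z * (apply_op N d (U t) v z - apply_op N d (U 0) v z))
      = apply_op N d ?W (apply_op N d (U t) v) x - apply_op N d ?W (apply_op N d (U 0) v) x"
    by (simp add: apply_op_def[of N d ?W] sum_subtractf algebra_simps)
  ultimately show "((\<lambda>s. - \<i> * (\<Sum>z\<in>cfg N d. rotate N (H s) x z * apply_op N d ?W (apply_op N d (U s) v) z))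
      has_integral apply_op N d ?W (apply_op N d (U t) v) x - apply_op N d ?W (apply_op N d (U 0) v) x) {0..t}"
    by (simp only:)
next
  show "rotate N (H t) x y = cnj (rotate N (H t) y x)"
    if "t \<in> {0..T}" "x \<in> cfg N d" "y \<in> cfg N d" for t x y
    using herm that by (intro rotate_hermitian) auto
qed (use T int opnorm_nonneg[OF d] sesq_rotate_le in auto)

text \<open>Summed over the Gram vectors, the squared amplitudes at \<open>x\<close> form a diagonal
  entry of the rotated state. When the evolved state is a tensor power of \<open>\<tau>\<close>,
  this is a product distribution, and the expected count reduces to one matrix entry. The matrix
  \<open>A\<close> stands for the propagator at either end of the evolution.\<close>

lemma expected_level_count_rotate:
  assumes l: "l < d" and tr: "(\<Sum>c<d. \<tau> c c) = 1"
    and \<tau>: "\<And>x y. x \<in> cfg N d \<Longrightarrow> y \<in> cfg N d \<Longrightarrow>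
      mmul N d (mmul N d A (\<lambda>z z'. \<Sum>L\<in>I. V L z * cnj (V L z'))) (adj A) x y = tpow N \<tau> x y"
  shows "(\<Sum>L\<in>I. \<Sum>x\<in>cfg N d. real (level_count N l x) *
      (cmod (apply_op N d (tpow N w) (apply_op N d A (V L)) x))\<^sup>2) = real N * Re (rotate1 \<tau> l l)"
proof -
  let ?W = "tpow N w" and ?R = "\<lambda>z z'. \<Sum>L\<in>I. V L z * cnj (V L z')"
  have outcome: "(\<Sum>L\<in>I. complex_of_real ((cmod (apply_op N d ?W (apply_op N d A (V L)) x))\<^sup>2))
      = (\<Prod>j<N. rotate1 \<tau> (x j) (x j))" if x: "x \<in> cfg N d" for x
  proof -
    have "(\<Sum>L\<in>I. complex_of_real ((cmod (apply_op N d ?W (apply_op N d A (V L)) x))\<^sup>2))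
        = mmul N d (mmul N d (mmul N d ?W A) ?R) (adj (mmul N d ?W A)) x x"
      unfolding complex_norm_square apply_op_mmul[symmetric] by (rule sum_apply_op_gram)
    also have "\<dots> = mmul N d ?W (mmul N d (mmul N d (mmul N d A ?R) (adj A)) (adj ?W)) x x"
      unfolding adj_mmul mmul_assoc ..
    also have "\<dots> = mmul N d ?W (mmul N d (tpow N \<tau>) ?W) x x"
      unfolding mmul_eq_apply_op[of N d ?W]
    proof (intro apply_op_cong refl)
      fix z assume z: "z \<in> cfg N d"
      show "mmul N d (mmul N d (mmul N d A ?R) (adj A)) (adj ?W) z x = mmul N d (tpow N \<tau>) ?W z x"
        unfolding mmul_def[of N d "mmul N d (mmul N d A ?R) (adj A)"] mmul_def[of N d "tpow N \<tau>"]
        by (intro sum.cong refl) (simp add: \<tau>[OF z] adj_def[of ?W] tpow_w_hermitian x)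
    qed
    also have "\<dots> = rotate N (tpow N \<tau>) x x"
      by (simp add: rotate_def mmul_assoc)
    also have "\<dots> = (\<Prod>j<N. rotate1 \<tau> (x j) (x j))"
      unfolding rotate_tpow by (simp add: tpow_def)
    finally show ?thesis .
  qed
  have "complex_of_real (\<Sum>L\<in>I. \<Sum>x\<in>cfg N d. real (level_count N l x) *
      (cmod (apply_op N d ?W (apply_op N d A (V L)) x))\<^sup>2)
      = (\<Sum>x\<in>cfg N d. of_nat (level_count N l x) *
        (\<Sum>L\<in>I. complex_of_real ((cmod (apply_op N d ?W (apply_op N d A (V L)) x))\<^sup>2)))"
    by (subst sum.swap) (simp add: sum_distrib_left)
  also have "\<dots> = (\<Sum>x\<in>cfg N d. of_nat (level_count N l x) * (\<Prod>j<N. rotate1 \<tau> (x j) (x j)))"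
    by (intro sum.cong refl) (simp only: outcome)
  also have "\<dots> = of_nat N * rotate1 \<tau> l l"
    by (rule expected_level_count[OF l]) (simp add: trace_rotate1 tr)
  finally have "Re (complex_of_real (\<Sum>L\<in>I. \<Sum>x\<in>cfg N d. real (level_count N l x) *
      (cmod (apply_op N d ?W (apply_op N d A (V L)) x))\<^sup>2)) = Re (of_nat N * rotate1 \<tau> l l)"
    by (rule arg_cong)
  then show ?thesis by simp
qed

lemma expected_level_count_initial:
  assumes "l < d" "(\<Sum>c<d. \<tau> c c) = 1"
    and "\<And>x y. x \<in> cfg N d \<Longrightarrow> y \<in> cfg N d \<Longrightarrow> A x y = idop x y"
    and "\<And>x y. x \<in> cfg N d \<Longrightarrow> y \<in> cfg N d \<Longrightarrow> (\<Sum>L\<in>I. V L x * cnj (V L y)) = tpow N \<tau> x y"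
  shows "(\<Sum>L\<in>I. \<Sum>x\<in>cfg N d. real (level_count N l x) *
      (cmod (apply_op N d (tpow N w) (apply_op N d A (V L)) x))\<^sup>2) = real N * Re (rotate1 \<tau> l l)"
proof (rule expected_level_count_rotate[where \<tau> = \<tau>, OF assms(1,2)])
  fix x y assume xy: "x \<in> cfg N d" "y \<in> cfg N d"
  have A: "apply_op N d A v z = v z" if "z \<in> cfg N d" for v z
    using apply_op_idop[OF that] apply_op_cong[of N d A z idop v v] assms(3)[OF that] by simp
  show "mmul N d (mmul N d A (\<lambda>z z'. \<Sum>L\<in>I. V L z * cnj (V L z'))) (adj A) x y = tpow N \<tau> x y"
    unfolding sum_apply_op_gram[symmetric] by (simp add: A xy assms(4))
qed

text \<open>The Bernstein estimate is applied to each evolved Gram vector. Its factor, the squared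
  norm of the vector, sums to the trace of the initial tensor power, which is 1, so mixedness costs
  nothing.\<close>

theorem level_population_change_le:
  assumes d: "1 \<le> d" and l: "l < d"
    and loc: "local_hamiltonian N d k m M h S H T"
    and ch: "charges N d (tpow N \<rho>) (tpow N \<sigma>) H T"
    and rho: "density d \<rho>" and sigma: "density d \<sigma>"
  shows "real N * \<bar>Re (rotate1 \<sigma> l l) - Re (rotate1 \<rho> l l)\<bar>
    \<le> real k * integral {0..T} (\<lambda>t. opnorm N d (H t))"
proof -
  let ?X = "cfg N d" and ?W = "tpow N w"
  obtain U where T: "0 < T" and herm: "\<forall>t\<in>{0..T}. hermitian N d (H t)"
    and int: "(\<lambda>t. opnorm N d (H t)) integrable_on {0..T}"
    and sch: "schroedinger N d H U T"
    and fin: "\<And>x y. x \<in> ?X \<Longrightarrow> y \<in> ?X \<Longrightarrow>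
      mmul N d (mmul N d (U T) (tpow N \<rho>)) (adj (U T)) x y = tpow N \<sigma> x y"
    using ch unfolding charges_def by blast
  have T0: "0 \<le> T" using T by simp
  obtain V1 :: "nat \<Rightarrow> nat \<Rightarrow> complex" where
    V1: "\<And>a b. a < d \<Longrightarrow> b < d \<Longrightarrow> \<rho> a b = (\<Sum>l<d. V1 l a * cnj (V1 l b))"
    using psd_gram_decomposition[of d \<rho>] rho unfolding density_def by blast
  define V where "V L x = (\<Prod>j<N. V1 (L j) (x j))" for L x :: "nat \<Rightarrow> nat"
  have V: "(\<Sum>L\<in>?X. V L x * cnj (V L y)) = tpow N \<rho> x y" if "x \<in> ?X" "y \<in> ?X" for x y
    unfolding V_def using tpow_gram_decomposition[OF V1 that] by simp
  define \<phi> where "\<phi> L t = apply_op N d ?W (apply_op N d (U t) (V L))" for L t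
  have ev: "evolution ?X (\<lambda>t. rotate N (H t)) (\<lambda>t. opnorm N d (H t)) (\<phi> L) T" for L
    unfolding \<phi>_def by (rule evolution_rotate[OF d T0 herm int sch])
  define g where "g L t = (\<Sum>x\<in>?X. real (level_count N l x) * (cmod (\<phi> L t x))\<^sup>2)" for L t
  have tr: "(\<Sum>c<d. \<rho> c c) = 1" "(\<Sum>c<d. \<sigma> c c) = 1"
    using rho sigma unfolding density_def by blast+
  have "(\<Sum>L\<in>?X. g L T) = real N * Re (rotate1 \<sigma> l l)"
    unfolding g_def \<phi>_def
  proof (rule expected_level_count_rotate[where \<tau> = \<sigma>, OF l tr(2)])
    fix x y assume xy: "x \<in> ?X" "y \<in> ?X"
    have "mmul N d (mmul N d (U T) (\<lambda>z z'. \<Sum>L\<in>?X. V L z * cnj (V L z'))) (adj (U T)) x y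
        = mmul N d (mmul N d (U T) (tpow N \<rho>)) (adj (U T)) x y"
      unfolding mmul_def by (simp add: V)
    then show "mmul N d (mmul N d (U T) (\<lambda>z z'. \<Sum>L\<in>?X. V L z * cnj (V L z'))) (adj (U T)) x y
        = tpow N \<sigma> x y"
      using fin[OF xy] by simp
  qed
  moreover have "(\<Sum>L\<in>?X. g L 0) = real N * Re (rotate1 \<rho> l l)"
    unfolding g_def \<phi>_def
    by (rule expected_level_count_initial[where \<tau> = \<rho>, OF l tr(1) schroedinger_initial[OF sch T0] V])
  ultimately have "real N * \<bar>Re (rotate1 \<sigma> l l) - Re (rotate1 \<rho> l l)\<bar> = \<bar>\<Sum>L\<in>?X. g L T - g L 0\<bar>"
    by (simp add: sum_subtractf abs_mult flip: right_diff_distrib)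
  also have "\<dots> \<le> (\<Sum>L\<in>?X. real k * (l2norm ?X (\<phi> L 0))\<^sup>2 * integral {0..T} (\<lambda>t. opnorm N d (H t)))"
  proof (rule order_trans[OF sum_abs sum_mono])
    fix L
    interpret evolution ?X "\<lambda>t. rotate N (H t)" "\<lambda>t. opnorm N d (H t)" "\<phi> L" T by (rule ev)
    show "\<bar>g L T - g L 0\<bar> \<le> real k * (l2norm ?X (\<phi> L 0))\<^sup>2 * integral {0..T} (\<lambda>t. opnorm N d (H t))"
      using graded_weight_diff_le[of 0 T "level_count N l" k] T0 rotate_local_hamiltonian_band[OF loc]
      unfolding g_def weight_def by blast
  qed
  also have "\<dots> = real k * integral {0..T} (\<lambda>t. opnorm N d (H t)) * (\<Sum>L\<in>?X. (l2norm ?X (\<phi> L 0))\<^sup>2)"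
    by (simp add: sum_distrib_left mult_ac)
  also have "(\<Sum>L\<in>?X. (l2norm ?X (\<phi> L 0))\<^sup>2) = 1"
  proof -
    have U0: "apply_op N d (U 0) v x = v x" if "x \<in> ?X" for v x
      using apply_op_idop[OF that] apply_op_cong[of N d "U 0" x idop v v]
        schroedinger_initial[OF sch T0 that] by simp
    have "(l2norm ?X (\<phi> L 0))\<^sup>2 = (\<Sum>x\<in>?X. (cmod (V L x))\<^sup>2)" for L
      unfolding \<phi>_def l2norm_tpow_w by (simp add: L2_set_def sum_nonneg U0)
    then have "complex_of_real (\<Sum>L\<in>?X. (l2norm ?X (\<phi> L 0))\<^sup>2)
        = (\<Sum>L\<in>?X. \<Sum>x\<in>?X. V L x * cnj (V L x))"
      by (simp only: of_real_sum complex_norm_square)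
    also have "\<dots> = (\<Sum>x\<in>?X. \<Sum>L\<in>?X. V L x * cnj (V L x))"
      by (rule sum.swap)
    also have "\<dots> = 1"
      by (simp add: V trace_tpow tr)
    finally show ?thesis using of_real_eq_1_iff by blast
  qed
  finally show ?thesis by simp
qed

text \<open>The Rabi flip. As the square of \<open>w\<close> is one, the propagator generated by
  \<open>E\<close> times its tensor power is the cosine times the identity minus \<i> times the sine
  times that power. At \<open>E * t = pi / 2\<close> it equals the rotation up to the phase -\<i>,
  which cancels under conjugation.\<close>

lemma rotation_charges:
  assumes d: "1 \<le> d" and E: "0 < E"
    and B: "\<And>x y. x \<in> cfg N d \<Longrightarrow> y \<in> cfg N d \<Longrightarrow> rotate N A x y = B x y"
  shows "charges N d A B (\<lambda>t x y. of_real E * tpow N w x y) (pi / (2 * E))"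
    and "avg_norm N d (\<lambda>t x y. of_real E * tpow N w x y) (pi / (2 * E)) \<le> E"
proof -
  let ?W = "tpow N w" and ?H = "\<lambda>x y. complex_of_real E * tpow N w x y" and ?T = "pi / (2 * E)"
  have T: "0 < ?T" using E by simp
  define U where "U t x y = of_real (cos (E * t)) * idop x y - \<i> * of_real (sin (E * t)) * ?W x y" for t x y
  have WW: "(\<Sum>z\<in>cfg N d. ?W x z * ?W z y) = idop x y" if "x \<in> cfg N d" "y \<in> cfg N d" for x y
    using tpow_one[OF that, of "\<lambda>a b. \<Sum>c<d. w a c * w c b"] w_square
      fun_cong[OF fun_cong[OF mmul_tpow[of N d w w]], of x y]
    by (simp add: mmul_def)
  have WI: "(\<Sum>z\<in>cfg N d. ?W x z * idop z y) = ?W x y" if "y \<in> cfg N d" for x y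
  proof -
    have "(\<Sum>z\<in>cfg N d. ?W x z * idop z y) = (\<Sum>z\<in>cfg N d. if z = y then ?W x z else 0)"
      by (intro sum.cong) (auto simp: idop_def)
    then show ?thesis using that by simp
  qed
  have sch: "schroedinger N d (\<lambda>_. ?H) U ?T"
    unfolding schroedinger_def
  proof (intro ballI)
    fix t x y assume t: "t \<in> {0..?T}" and xy: "x \<in> cfg N d" "y \<in> cfg N d"
    have sum: "(\<Sum>z\<in>cfg N d. ?H x z * U s z y)
        = of_real E * (of_real (cos (E * s)) * (\<Sum>z\<in>cfg N d. ?W x z * idop z y)
          - \<i> * of_real (sin (E * s)) * (\<Sum>z\<in>cfg N d. ?W x z * ?W z y))" for s
      unfolding U_def sum_distrib_left sum_subtractf[symmetric]
      by (intro sum.cong refl) (simp add: algebra_simps)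
    have vel: "- \<i> * (\<Sum>z\<in>cfg N d. ?H x z * U s z y)
        = - \<i> * of_real (E * cos (E * s)) * ?W x y - of_real (E * sin (E * s)) * idop x y" for s
      unfolding sum WI[OF xy(2)] WW[OF xy] by (simp add: algebra_simps)
    have "((\<lambda>s. - \<i> * (\<Sum>z\<in>cfg N d. ?H x z * U s z y)) has_integral (U t x y - U 0 x y)) {0..t}"
      unfolding vel
    proof (rule fundamental_theorem_of_calculus)
      show "((\<lambda>s. U s x y) has_vector_derivative
          - \<i> * of_real (E * cos (E * s)) * ?W x y - of_real (E * sin (E * s)) * idop x y)
          (at s within {0..t})" for s
        unfolding U_def by (auto intro!: derivative_eq_intros has_vector_derivative_of_real
            simp: algebra_simps has_vector_derivative_def scaleR_conv_of_real)
    qed (use t in auto)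
    then show "((\<lambda>s. - \<i> * (\<Sum>z\<in>cfg N d. ?H x z * U s z y)) has_integral (U t x y - idop x y)) {0..t}"
      by (simp add: U_def)
  qed
  have UT: "U ?T = (\<lambda>x y. - \<i> * ?W x y)" unfolding U_def using E by (intro ext) simp
  have final: "mmul N d (mmul N d (U ?T) A) (adj (U ?T)) x y = B x y"
    if "x \<in> cfg N d" "y \<in> cfg N d" for x y
  proof -
    have "mmul N d (mmul N d (U ?T) A) (adj (U ?T)) x y
        = (\<Sum>z\<in>cfg N d. (\<Sum>z'\<in>cfg N d. ?W x z' * A z' z) * ?W z y)"
      unfolding UT mmul_def adj_def using that
      by (intro sum.cong refl) (simp add: tpow_w_hermitian sum_distrib_left sum_negf mult_ac)
    then show ?thesis using B[OF that] by (simp add: rotate_def mmul_def)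
  qed
  show "charges N d A B (\<lambda>t. ?H) ?T"
    unfolding charges_def
    using T sch final by (auto simp: hermitian_def tpow_w_hermitian)
  have "opnorm N d ?H \<le> E"
  proof (rule opnorm_le[OF d])
    fix v assume v: "vnorm N d v = 1"
    have "apply_op N d ?H v x = of_real E * apply_op N d ?W v x" for x
      by (simp add: apply_op_def sum_distrib_left mult_ac)
    then have "vnorm N d (apply_op N d ?H v) = E * vnorm N d (apply_op N d ?W v)"
      unfolding vnorm_eq_l2norm using L2_set_right_distrib[of E _ "cfg N d"] E
      by (simp add: norm_mult)
    also have "vnorm N d (apply_op N d ?W v) = 1"
      using v unfolding vnorm_eq_l2norm l2norm_tpow_w .
    finally show "vnorm N d (apply_op N d ?H v) \<le> E" by simp
  qed
  then show "avg_norm N d (\<lambda>t. ?H) ?T \<le> E"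
    unfolding avg_norm_def using T E by (simp add: field_simps)
qed

end

section \<open>Choice of basis, the Rabi flip and the charging bound\<close>

lemma involution_identity: "involution d (\<lambda>a b. if a = b then 1 else 0)"
proof
  fix a b assume "a < d" "b < d"
  have "(\<Sum>c<d. (if a = c then 1 else 0) * (if c = b then 1 else 0 :: complex))
      = (\<Sum>c<d. if c = a then (if a = b then 1 else 0) else 0)"
    by (intro sum.cong) auto
  then show "(\<Sum>c<d. (if a = c then 1 else 0) * (if c = b then 1 else 0 :: complex)) = (if a = b then 1 else 0)"
    using \<open>a < d\<close> by simp
qed auto

lemma rotate1_identity:
  assumes "a < d" "b < d"
  shows "involution.rotate1 d (\<lambda>a b. if a = b then 1 else 0) A a b = A a b"
proof -
  interpret involution d "\<lambda>a b. if a = b then 1 else 0" by (rule involution_identity)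
  have "(\<Sum>e<d. (if a = e then 1 else 0) * A e c) = A a c" for c
  proof -
    have "(\<Sum>e<d. (if a = e then 1 else 0) * A e c) = (\<Sum>e<d. if e = a then A e c else 0)"
      by (intro sum.cong) auto
    then show ?thesis using assms by simp
  qed
  moreover have "(\<Sum>c<d. A a c * (if c = b then 1 else 0)) = A a b"
  proof -
    have "(\<Sum>c<d. A a c * (if c = b then 1 else 0)) = (\<Sum>c<d. if c = b then A a c else 0)"
      by (intro sum.cong) auto
    then show ?thesis using assms by simp
  qed
  ultimately show ?thesis by (simp add: rotate1_def)
qed

text \<open>On the levels \<open>i\<close> and \<open>j\<close> this is a Hadamard gate twisted by a phase; conjugating with it moves
  the real part of an off-diagonal entry, rotated by that phase, to the diagonal.\<close>

definition mixer :: "nat \<Rightarrow> nat \<Rightarrow> complex \<Rightarrow> nat \<Rightarrow> nat \<Rightarrow> complex" where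
  "mixer i j \<zeta> a b =
    (if a = i then (if b = i then 1 else if b = j then \<zeta> else 0) / of_real (sqrt 2)
     else if a = j then (if b = i then cnj \<zeta> else if b = j then - 1 else 0) / of_real (sqrt 2)
     else if a = b then 1 else 0)"

lemma sum_lessThan_two:
  fixes F :: "nat \<Rightarrow> 'b::comm_monoid_add"
  assumes "i < d" "j < d" "i \<noteq> j" "\<And>c. c < d \<Longrightarrow> c \<noteq> i \<Longrightarrow> c \<noteq> j \<Longrightarrow> F c = 0"
  shows "(\<Sum>c<d. F c) = F i + F j"
proof -
  have "(\<Sum>c<d. F c) = (\<Sum>c\<in>{i, j}. F c)"
    using assms by (intro sum.mono_neutral_right) auto
  then show ?thesis using assms(3) by simp
qed

lemma mixer_row:
  assumes "i < d" "j < d" "i \<noteq> j" "a < d"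
  shows "(\<Sum>c<d. mixer i j \<zeta> a c * F c) =
    (if a = i then (F i + \<zeta> * F j) / of_real (sqrt 2)
     else if a = j then (cnj \<zeta> * F i - F j) / of_real (sqrt 2) else F a)"
proof -
  consider "a = i" | "a = j" | "a \<noteq> i" "a \<noteq> j" by blast
  then show ?thesis
  proof cases
    case 3
    then have "(\<Sum>c<d. mixer i j \<zeta> a c * F c) = (\<Sum>c<d. if c = a then F c else 0)"
      by (intro sum.cong) (auto simp: mixer_def)
    then show ?thesis using 3 assms by simp
  qed (use assms in \<open>simp_all add: sum_lessThan_two[OF assms(1-3)] mixer_def add_divide_distrib diff_divide_distrib\<close>)
qed

lemma involution_mixer:
  assumes "i < d" "j < d" "i \<noteq> j" "cmod \<zeta> = 1"
  shows "involution d (mixer i j \<zeta>)"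
proof
  show "cnj (mixer i j \<zeta> a b) = mixer i j \<zeta> b a" for a b
    using assms(3) by (auto simp: mixer_def)
  have \<zeta>: "\<zeta> * cnj \<zeta> = 1" "cnj \<zeta> * \<zeta> = 1"
    using assms(4) complex_norm_square[of \<zeta>] by (simp_all add: mult.commute)
  have two: "complex_of_real (sqrt 2) * complex_of_real (sqrt 2) = 2"
    by (simp flip: of_real_mult)
  fix a b assume "a < d" "b < d"
  then show "(\<Sum>c<d. mixer i j \<zeta> a c * mixer i j \<zeta> c b) = (if a = b then 1 else 0)"
    unfolding mixer_row[OF assms(1-3) \<open>a < d\<close>]
    using assms(3) by (auto simp: mixer_def \<zeta> two add_divide_distrib[symmetric] diff_divide_distrib[symmetric])
qed

lemma rotate1_mixer:
  assumes "i < d" "j < d" "i \<noteq> j" "cmod \<zeta> = 1"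
  shows "involution.rotate1 d (mixer i j \<zeta>) A i i = (A i i + A j j + \<zeta> * A j i + cnj \<zeta> * A i j) / 2"
proof -
  interpret involution d "mixer i j \<zeta>" by (rule involution_mixer[OF assms])
  have two: "complex_of_real (sqrt 2) * complex_of_real (sqrt 2) = 2"
    by (simp flip: of_real_mult)
  have \<zeta>: "\<zeta> * cnj \<zeta> = 1"
    using assms(4) complex_norm_square[of \<zeta>] by simp
  have "rotate1 A i i = (\<Sum>c<d. (A i c + \<zeta> * A j c) / of_real (sqrt 2) * mixer i j \<zeta> c i)"
    unfolding rotate1_def by (simp add: mixer_row[OF assms(1-3)] assms)
  also have "\<dots> = (A i i + \<zeta> * A j i) / of_real (sqrt 2) * mixer i j \<zeta> i i
      + (A i j + \<zeta> * A j j) / of_real (sqrt 2) * mixer i j \<zeta> j i"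
    by (rule sum_lessThan_two[OF assms(1-3)]) (auto simp: mixer_def)
  also have "\<dots> = (A i i + \<zeta> * A j i + (A i j + \<zeta> * A j j) * cnj \<zeta>) / 2"
    using assms(3) by (simp add: mixer_def two add_divide_distrib[symmetric])
  also have "\<dots> = (A i i + A j j * (\<zeta> * cnj \<zeta>) + \<zeta> * A j i + cnj \<zeta> * A i j) / 2"
    by (simp add: algebra_simps)
  finally show ?thesis by (simp add: \<zeta>)
qed

text \<open>If the diagonals differ, the identity works. Otherwise some off-diagonal entry differs,
  and a mixer on those two levels brings the difference onto the diagonal.\<close>

lemma distinguishing_involution:
  assumes "\<And>a b. a < d \<Longrightarrow> b < d \<Longrightarrow> \<rho> a b = cnj (\<rho> b a)"
    and "\<And>a b. a < d \<Longrightarrow> b < d \<Longrightarrow> \<sigma> a b = cnj (\<sigma> b a)"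
    and ne: "i < d" "j < d" "\<rho> i j \<noteq> \<sigma> i j"
  obtains w l where "involution d w" "l < d"
    "Re (involution.rotate1 d w \<sigma> l l) \<noteq> Re (involution.rotate1 d w \<rho> l l)"
proof (cases "\<forall>a<d. \<rho> a a = \<sigma> a a")
  case False
  then obtain a where a: "a < d" "\<rho> a a \<noteq> \<sigma> a a" by blast
  have "Im (\<rho> a a) = 0" "Im (\<sigma> a a) = 0"
    using assms(1)[OF a(1) a(1)] assms(2)[OF a(1) a(1)] by (simp_all add: complex_eq_iff)
  then have "Re (\<sigma> a a) \<noteq> Re (\<rho> a a)" using a(2) by (auto simp: complex_eq_iff)
  then show ?thesis
    using that[OF involution_identity a(1)] by (simp add: rotate1_identity a(1))
next
  case True
  then have ij: "i \<noteq> j" using ne by auto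
  define z where "z = \<sigma> j i - \<rho> j i"
  have z: "z \<noteq> 0" using ne assms(1)[OF ne(1,2)] assms(2)[OF ne(1,2)] by (auto simp: z_def)
  \<comment> \<open>The phase is aligned with \<open>z\<close>, so both off-diagonal contributions
    equal \<open>cmod z\<close> and cannot cancel.\<close>
  define \<zeta> where "\<zeta> = cnj (sgn z)"
  have \<zeta>: "cmod \<zeta> = 1" using z by (simp add: \<zeta>_def norm_sgn)
  have 1: "\<zeta> * z = of_real (cmod z)"
    unfolding \<zeta>_def sgn_eq by (simp add: complex_norm_square[symmetric] mult.commute power2_eq_square flip: of_real_power)
  have "\<sigma> i j - \<rho> i j = cnj z"
    using assms(1)[OF ne(1,2)] assms(2)[OF ne(1,2)] by (simp add: z_def)
  then have 2: "cnj \<zeta> * (\<sigma> i j - \<rho> i j) = of_real (cmod z)"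
    using arg_cong[OF 1, of cnj] by simp
  have "involution.rotate1 d (mixer i j \<zeta>) \<sigma> i i - involution.rotate1 d (mixer i j \<zeta>) \<rho> i i
      = (\<zeta> * z + cnj \<zeta> * (\<sigma> i j - \<rho> i j)) / 2"
    unfolding rotate1_mixer[OF ne(1,2) ij \<zeta>] z_def using True ne by (simp add: field_simps)
  also have "\<dots> = of_real (cmod z)" unfolding 1 2 by simp
  finally have "Re (involution.rotate1 d (mixer i j \<zeta>) \<sigma> i i - involution.rotate1 d (mixer i j \<zeta>) \<rho> i i) = cmod z"
    by simp
  then have "Re (involution.rotate1 d (mixer i j \<zeta>) \<sigma> i i) \<noteq> Re (involution.rotate1 d (mixer i j \<zeta>) \<rho> i i)"
    using z by auto
  then show ?thesis by (rule that[OF involution_mixer[OF ne(1,2) ij \<zeta>] ne(1)])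
qed

section \<open>Full charging from the bottom to the top level\<close>

definition level_swap :: "nat \<Rightarrow> nat \<Rightarrow> nat \<Rightarrow> complex" where
  "level_swap d a b = (if b = (if a = 0 then d - 1 else if a = d - 1 then 0 else a) then 1 else 0)"

lemma involution_level_swap:
  assumes "1 \<le> d"
  shows "involution d (level_swap d)"
proof
  show "cnj (level_swap d a b) = level_swap d b a" for a b
    by (auto simp: level_swap_def)
  fix a b assume ab: "a < d" "b < d"
  let ?s = "if a = 0 then d - 1 else if a = d - 1 then 0 else a"
  have "(\<Sum>c<d. level_swap d a c * level_swap d c b) = (\<Sum>c<d. if c = ?s then level_swap d c b else 0)"
    by (intro sum.cong) (auto simp: level_swap_def)
  also have "\<dots> = level_swap d ?s b" using ab by (subst sum.delta) auto
  also have "\<dots> = (if a = b then 1 else 0)" by (auto simp: level_swap_def)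
  finally show "(\<Sum>c<d. level_swap d a c * level_swap d c b) = (if a = b then 1 else 0)" .
qed

lemma rotate1_level_swap_ground:
  assumes "1 \<le> d" "a < d" "b < d"
    and "\<And>i j. i < d \<Longrightarrow> j < d \<Longrightarrow> \<rho> i j = (if i = 0 \<and> j = 0 then 1 else 0)"
  shows "involution.rotate1 d (level_swap d) \<rho> a b = (if a = d - 1 \<and> b = d - 1 then 1 else 0)"
proof -
  interpret involution d "level_swap d" by (rule involution_level_swap[OF assms(1)])
  have "(\<Sum>e<d. level_swap d a e * \<rho> e c) = (if c = 0 then level_swap d a 0 else 0)" if "c < d" for c
  proof -
    have "(\<Sum>e<d. level_swap d a e * \<rho> e c)
        = (\<Sum>e<d. if e = 0 then (if c = 0 then level_swap d a e else 0) else 0)"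
      using that by (intro sum.cong) (auto simp: assms(4))
    then show ?thesis using assms(1) by simp
  qed
  then have "rotate1 \<rho> a b = (\<Sum>c<d. if c = 0 then level_swap d a 0 * level_swap d c b else 0)"
    unfolding rotate1_def by (intro sum.cong) auto
  also have "\<dots> = level_swap d a 0 * level_swap d 0 b" using assms(1) by simp
  finally show ?thesis using assms(1-3) by (auto simp: level_swap_def)
qed

text \<open>The ground state is pure, so one unit vector serves as its Gram decomposition and the
  strict estimate for single vectors applies.\<close>

lemma tpow_ground:
  assumes "1 \<le> d" "x \<in> cfg N d" "y \<in> cfg N d"
    and "\<And>i j. i < d \<Longrightarrow> j < d \<Longrightarrow> \<rho> i j = (if i = 0 \<and> j = 0 then 1 else 0)"
  shows "tpow N \<rho> x y = idop (\<lambda>j\<in>{..<N}. 0) x * cnj (idop (\<lambda>j\<in>{..<N}. 0) y)"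
proof -
  have ground: "(\<Prod>j<N. if z j = 0 then 1 else 0) = idop (\<lambda>j\<in>{..<N}. 0) z" if "z \<in> cfg N d" for z
  proof (cases "\<forall>j<N. z j = 0")
    case True
    have "(\<lambda>j\<in>{..<N}. 0) = z"
    proof
      fix j
      show "(\<lambda>j\<in>{..<N}. 0) j = z j"
        using True PiE_arb[OF that[unfolded cfg_def], of j] by (cases "j < N") simp_all
    qed
    then show ?thesis using True by (simp add: idop_def)
  next
    case False
    then obtain j where j: "j < N" "z j \<noteq> 0" by blast
    then have "(\<lambda>j\<in>{..<N}. 0) j \<noteq> z j" by simp
    then have "(\<lambda>j\<in>{..<N}. 0) \<noteq> z" by (rule contrapos_nn) (rule fun_cong)
    moreover have "(\<Prod>j<N. if z j = 0 then 1 else 0 :: complex) = 0"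
      using j by (intro prod_zero) auto
    ultimately show ?thesis by (simp add: idop_def)
  qed
  have "tpow N \<rho> x y = (\<Prod>j<N. (if x j = 0 then 1 else 0) * (if y j = 0 then 1 else 0))"
    unfolding tpow_def using cfg_less[OF assms(2)] cfg_less[OF assms(3)]
    by (intro prod.cong) (auto simp: assms(4))
  then show ?thesis by (simp add: prod.distrib ground assms idop_def)
qed

text \<open>In the energy basis, taken with the identity involution, the count of batteries in the
  top level runs from 0 to \<open>N\<close>. It thus starts at the bottom of its range, where the
  variance argument gains.\<close>

theorem full_charging_less:
  assumes d: "2 \<le> d" and N: "1 \<le> N" and k: "1 \<le> k"
    and loc: "local_hamiltonian N d k m M h S H T"
    and ch: "charges N d (tpow N \<rho>) (tpow N \<sigma>) H T"
    and rho: "\<And>i j. i < d \<Longrightarrow> j < d \<Longrightarrow> \<rho> i j = (if i = 0 \<and> j = 0 then 1 else 0)"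
    and sigma: "\<And>i j. i < d \<Longrightarrow> j < d \<Longrightarrow> \<sigma> i j = (if i = d - 1 \<and> j = d - 1 then 1 else 0)"
  shows "real N < real k * integral {0..T} (\<lambda>t. opnorm N d (H t))"
proof -
  let ?X = "cfg N d" and ?w = "\<lambda>a b :: nat. if a = b then 1 else 0 :: complex"
  interpret involution d ?w by (rule involution_identity)
  have d1: "1 \<le> d" and l: "d - 1 < d" using d by auto
  obtain U where T: "0 < T" and herm: "\<forall>t\<in>{0..T}. hermitian N d (H t)"
    and int: "(\<lambda>t. opnorm N d (H t)) integrable_on {0..T}"
    and sch: "schroedinger N d H U T"
    and target: "\<And>x y. x \<in> ?X \<Longrightarrow> y \<in> ?X \<Longrightarrow>
      mmul N d (mmul N d (U T) (tpow N \<rho>)) (adj (U T)) x y = tpow N \<sigma> x y"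
    using ch unfolding charges_def by blast
  have T0: "0 \<le> T" using T by simp
  define v where "v = idop (\<lambda>j\<in>{..<N}. 0)"
  \<comment> \<open>A family with one member, so that the ensemble lemmas on expected counts apply
    to a single vector.\<close>
  define V where "V = (\<lambda>_ :: unit. v)"
  have V: "(\<Sum>L\<in>{()}. V L x * cnj (V L y)) = tpow N \<rho> x y" if "x \<in> ?X" "y \<in> ?X" for x y
    using tpow_ground[OF d1 that rho] by (simp add: V_def v_def)
  define \<phi> where "\<phi> t = apply_op N d (tpow N ?w) (apply_op N d (U t) v)" for t
  interpret evolution ?X "\<lambda>t. rotate N (H t)" "\<lambda>t. opnorm N d (H t)" \<phi> T
    unfolding \<phi>_def by (rule evolution_rotate[OF d1 T0 herm int sch])
  have "(\<Sum>c<d. \<rho> c c) = (\<Sum>c<d. if c = 0 then 1 else 0)"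
    by (intro sum.cong) (auto simp: rho)
  then have tr_rho: "(\<Sum>c<d. \<rho> c c) = 1" using d by simp
  have "(\<Sum>c<d. \<sigma> c c) = (\<Sum>c<d. if c = d - 1 then 1 else 0)"
    by (intro sum.cong) (auto simp: sigma)
  then have tr_sigma: "(\<Sum>c<d. \<sigma> c c) = 1" using d by simp
  have "(\<Sum>L\<in>{()}. \<Sum>x\<in>?X. real (level_count N (d - 1) x) *
      (cmod (apply_op N d (tpow N ?w) (apply_op N d (U T) (V L)) x))\<^sup>2) = real N * Re (rotate1 \<sigma> (d - 1) (d - 1))"
  proof (rule expected_level_count_rotate[where \<tau> = \<sigma>, OF l tr_sigma])
    fix x y assume xy: "x \<in> ?X" "y \<in> ?X"
    have "mmul N d (mmul N d (U T) (\<lambda>z z'. \<Sum>L\<in>{()}. V L z * cnj (V L z'))) (adj (U T)) x y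
        = mmul N d (mmul N d (U T) (tpow N \<rho>)) (adj (U T)) x y"
      unfolding mmul_def by (intro sum.cong refl arg_cong2[where f="(*)"] V)
    then show "mmul N d (mmul N d (U T) (\<lambda>z z'. \<Sum>L\<in>{()}. V L z * cnj (V L z'))) (adj (U T)) x y
        = tpow N \<sigma> x y"
      using target[OF xy] by simp
  qed
  then have final: "weight (level_count N (d - 1)) T = real N"
    unfolding weight_def \<phi>_def using l by (simp add: V_def rotate1_identity sigma)
  have "(\<Sum>L\<in>{()}. \<Sum>x\<in>?X. real (level_count N (d - 1) x) *
      (cmod (apply_op N d (tpow N ?w) (apply_op N d (U 0) (V L)) x))\<^sup>2) = real N * Re (rotate1 \<rho> (d - 1) (d - 1))"
    by (rule expected_level_count_initial[where \<tau> = \<rho>, OF l tr_rho schroedinger_initial[OF sch T0] V])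
  then have start: "weight (level_count N (d - 1)) 0 = 0"
    unfolding weight_def \<phi>_def using l d by (simp add: V_def rotate1_identity rho)
  have unit: "l2norm ?X (\<phi> 0) = 1"
  proof -
    have U0: "apply_op N d (U 0) v x = v x" if "x \<in> ?X" for x
      using apply_op_idop[OF that] apply_op_cong[of N d "U 0" x idop v v]
        schroedinger_initial[OF sch T0 that] by simp
    have "(\<Sum>x\<in>?X. (cmod (v x))\<^sup>2) = (\<Sum>x\<in>?X. if x = (\<lambda>j\<in>{..<N}. 0) then 1 else 0)"
      by (intro sum.cong) (auto simp: v_def idop_def)
    also have "\<dots> = 1" using constant_cfg[of 0 d N] d by simp
    finally show ?thesis
      unfolding \<phi>_def l2norm_tpow_w by (simp add: L2_set_def U0)
  qed
  show ?thesis
    by (rule graded_weight_full_range_less[OF rotate_local_hamiltonian_band[OF loc] level_count_le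
          unit start final N k])
qed

text \<open>Idling with the zero Hamiltonian takes any positive time, and the positive times have no
  least element.\<close>

lemma trivial_charges:
  assumes d: "1 \<le> d" and T: "0 < T"
    and AB: "\<And>x y. x \<in> cfg N d \<Longrightarrow> y \<in> cfg N d \<Longrightarrow> A x y = B x y"
  shows "charges N d A B (\<lambda>t x y. 0) T" and "avg_norm N d (\<lambda>t x y. 0) T \<le> 0"
proof -
  have "opnorm N d (\<lambda>x y. 0) \<le> 0"
    by (rule opnorm_le[OF d]) (simp add: apply_op_def vnorm_def)
  then show "avg_norm N d (\<lambda>t x y. 0) T \<le> 0"
    unfolding avg_norm_def using T by (simp add: mult_nonneg_nonpos)
  have "mmul N d (mmul N d idop A) (adj idop) x y = A x y" if xy: "x \<in> cfg N d" "y \<in> cfg N d" for x y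
  proof -
    have "mmul N d (mmul N d idop A) (adj idop) x y = (\<Sum>z\<in>cfg N d. if z = y then A x z else 0)"
      unfolding mmul_def[of N d "mmul N d idop A"]
      by (intro sum.cong) (auto simp: mmul_eq_apply_op apply_op_idop[OF xy(1)] adj_def idop_def)
    then show ?thesis using xy(2) by simp
  qed
  then show "charges N d A B (\<lambda>t x y. 0) T"
    unfolding charges_def schroedinger_def using T AB
    by (auto simp: hermitian_def intro!: exI[of _ "\<lambda>_. idop"])
qed

lemma integral_opnorm_le_of_avg_norm_le:
  assumes "0 < T" "avg_norm N d H T \<le> real N * E"
  shows "integral {0..T} (\<lambda>t. opnorm N d (H t)) \<le> real N * (E * T)"
  using assms unfolding avg_norm_def by (simp add: field_simps)

text \<open>Passes from the rate \<open>k\<close> of Bernstein's inequality to the factor in the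
  claim; the added term is nonnegative as \<open>m\<close> is at least 1.\<close>

lemma interaction_order_le:
  assumes "1 \<le> m"
  shows "real k \<le> real k ^ 2 * (real m - 1) + real k"
  using assms by simp

theorem theorem2:
  fixes d :: nat and lam :: "nat \<Rightarrow> real"
    and \<rho> \<sigma> :: "nat \<Rightarrow> nat \<Rightarrow> complex"
    and H1 :: "real \<Rightarrow> nat \<Rightarrow> nat \<Rightarrow> complex" and T1 :: real
  assumes lam_mono: "\<forall>i j. i \<le> j \<and> j < d \<longrightarrow> lam i \<le> lam j"
    and lam_sym: "lam (d - 1) - lam 0 = 2 * lam (d - 1)"
    and lam_pos: "2 * lam (d - 1) > 0"
    and rho: "density d \<rho>" and sigma: "density d \<sigma>"
    and opt: "optimal_single d \<rho> \<sigma> H1 T1"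
  shows "(\<exists>\<gamma>::real. \<forall>N k m (M :: nat set) h S H T.
            N \<ge> 1 \<longrightarrow> k \<ge> 1 \<longrightarrow> m \<ge> 1 \<longrightarrow>
            local_hamiltonian N d k m M h S H T \<longrightarrow>
            charges N d (tpow N \<rho>) (tpow N \<sigma>) H T \<longrightarrow>
            avg_norm N d H T \<le> real N * avg_norm 1 d (\<lambda>t. tpow 1 (H1 t)) T1 \<longrightarrow>
            T1 / T < \<gamma> * (real k ^ 2 * (real m - 1) + real k))
       \<and> ((\<forall>i<d. \<forall>j<d. \<rho> i j = (if i = 0 \<and> j = 0 then 1 else 0)) \<and>
          (\<forall>i<d. \<forall>j<d. \<sigma> i j = (if i = d - 1 \<and> j = d - 1 then 1 else 0)) \<longrightarrow>
          (\<forall>N k m (M :: nat set) h S H T.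
            N \<ge> 1 \<longrightarrow> k \<ge> 1 \<longrightarrow> m \<ge> 1 \<longrightarrow>
            local_hamiltonian N d k m M h S H T \<longrightarrow>
            charges N d (tpow N \<rho>) (tpow N \<sigma>) H T \<longrightarrow>
            avg_norm N d H T \<le> real N * avg_norm 1 d (\<lambda>t. tpow 1 (H1 t)) T1 \<longrightarrow>
            T1 / T < pi / 2 * (real k ^ 2 * (real m - 1) + real k)))"
proof -
  let ?H1 = "\<lambda>t. tpow 1 (H1 t)"
  define E where "E = avg_norm 1 d ?H1 T1"
  \<comment> \<open>With fewer than two levels the top and bottom eigenvalues would coincide,
    contradicting the positive spectral width.\<close>
  have "d - 1 \<noteq> 0" using lam_sym lam_pos by (metis cancel_comm_monoid_add_class.diff_cancel less_irrefl)
  then have d2: "2 \<le> d" and d1: "1 \<le> d" by auto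
  have ch1: "charges 1 d (tpow 1 \<rho>) (tpow 1 \<sigma>) ?H1 T1"
    and fastest: "\<And>H' T'. charges 1 d (tpow 1 \<rho>) (tpow 1 \<sigma>) H' T' \<Longrightarrow> avg_norm 1 d H' T' \<le> E \<Longrightarrow> T1 \<le> T'"
    using opt unfolding optimal_single_def E_def by blast+
  have T1: "0 < T1" and int1: "(\<lambda>t. opnorm 1 d (?H1 t)) integrable_on {0..T1}"
    using ch1 unfolding charges_def by auto
  have E: "0 \<le> E"
    unfolding E_def avg_norm_def using T1 opnorm_nonneg[OF d1]
    by (intro divide_nonneg_pos integral_nonneg int1) auto
  have "\<exists>i<d. \<exists>j<d. \<rho> i j \<noteq> \<sigma> i j"
  proof (rule ccontr)
    assume "\<not> (\<exists>i<d. \<exists>j<d. \<rho> i j \<noteq> \<sigma> i j)"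
    then have eq: "tpow 1 \<rho> x y = tpow 1 \<sigma> x y" if "x \<in> cfg 1 d" "y \<in> cfg 1 d" for x y
      using cfg_less[OF that(1), of 0] cfg_less[OF that(2), of 0] by (simp add: tpow_def)
    have T1': "0 < T1 / 2" using T1 by simp
    note idle = trivial_charges[of d "T1 / 2" 1 "tpow 1 \<rho>" "tpow 1 \<sigma>", OF d1 T1' eq]
    have "T1 \<le> T1 / 2" by (rule fastest[OF idle(1) order_trans[OF idle(2) E]])
    then show False using T1 by simp
  qed
  then obtain i j where ij: "i < d" "j < d" "\<rho> i j \<noteq> \<sigma> i j" by blast
  have herm: "\<And>a b. a < d \<Longrightarrow> b < d \<Longrightarrow> \<rho> a b = cnj (\<rho> b a)"
    "\<And>a b. a < d \<Longrightarrow> b < d \<Longrightarrow> \<sigma> a b = cnj (\<sigma> b a)"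
    using rho sigma unfolding density_def by blast+
  obtain w l where w: "involution d w" and l: "l < d"
    and diff: "Re (involution.rotate1 d w \<sigma> l l) \<noteq> Re (involution.rotate1 d w \<rho> l l)"
    by (rule distinguishing_involution[OF herm ij])
  define a where "a = \<bar>Re (involution.rotate1 d w \<sigma> l l) - Re (involution.rotate1 d w \<rho> l l)\<bar>"
  have a: "0 < a" using diff by (simp add: a_def)
  \<comment> \<open>The population estimate alone gives a weak inequality with
    \<open>T1 * E / a\<close>; the added 1 makes it strict. The quantities \<open>T1\<close>,
    \<open>E\<close> and \<open>a\<close> are all fixed before \<open>N\<close> and the collective
    protocol are chosen.\<close>
  have general: "T1 / T < (T1 * E / a + 1) * (real k ^ 2 * (real m - 1) + real k)"
    if N: "1 \<le> N" and k: "1 \<le> k" and m: "1 \<le> m"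
      and loc: "local_hamiltonian N d k m M h S H T"
      and ch: "charges N d (tpow N \<rho>) (tpow N \<sigma>) H T"
      and C0: "avg_norm N d H T \<le> real N * E" for N k m M h S H T
  proof -
    have T: "0 < T" using ch unfolding charges_def by blast
    have "real N * a \<le> real k * integral {0..T} (\<lambda>t. opnorm N d (H t))"
      unfolding a_def by (rule involution.level_population_change_le[OF w d1 l loc ch rho sigma])
    also have "\<dots> \<le> real k * (real N * (E * T))"
      by (intro mult_left_mono integral_opnorm_le_of_avg_norm_le T C0) auto
    finally have "real N * a \<le> real N * (real k * (E * T))" by (simp add: mult_ac)
    then have "a \<le> real k * (E * T)" using N by simp
    then have "T1 * a \<le> T1 * (real k * (E * T))" using T1 by simp
    then have "T1 / T \<le> T1 * E / a * real k" using T a by (simp add: field_simps)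
    also have "\<dots> < (T1 * E / a + 1) * real k" using k by (simp add: distrib_right)
    also have "\<dots> \<le> (T1 * E / a + 1) * (real k ^ 2 * (real m - 1) + real k)"
      using T1 E a by (intro mult_left_mono interaction_order_le m) auto
    finally show ?thesis .
  qed
  have extremal: "T1 / T < pi / 2 * (real k ^ 2 * (real m - 1) + real k)"
    if ground: "\<forall>i<d. \<forall>j<d. \<rho> i j = (if i = 0 \<and> j = 0 then 1 else 0)"
      and excited: "\<forall>i<d. \<forall>j<d. \<sigma> i j = (if i = d - 1 \<and> j = d - 1 then 1 else 0)"
      and N: "1 \<le> N" and k: "1 \<le> k" and m: "1 \<le> m"
      and loc: "local_hamiltonian N d k m M h S H T"
      and ch: "charges N d (tpow N \<rho>) (tpow N \<sigma>) H T"
      and C0: "avg_norm N d H T \<le> real N * E" for N k m M h S H T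
  proof -
    have \<rho>: "\<And>i j. i < d \<Longrightarrow> j < d \<Longrightarrow> \<rho> i j = (if i = 0 \<and> j = 0 then 1 else 0)"
      and \<sigma>: "\<And>i j. i < d \<Longrightarrow> j < d \<Longrightarrow> \<sigma> i j = (if i = d - 1 \<and> j = d - 1 then 1 else 0)"
      using ground excited by blast+
    have T: "0 < T" using ch unfolding charges_def by blast
    have "real N < real k * integral {0..T} (\<lambda>t. opnorm N d (H t))"
      by (rule full_charging_less[OF d2 N k loc ch \<rho> \<sigma>])
    also have "\<dots> \<le> real k * (real N * (E * T))"
      by (intro mult_left_mono integral_opnorm_le_of_avg_norm_le T C0) auto
    finally have "real N * 1 < real N * (real k * (E * T))" by (simp add: mult_ac)
    then have kET: "1 < real k * (E * T)" using N by simp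
    \<comment> \<open>The comparison flip runs at strength \<open>E\<close>, so its duration
      requires \<open>E\<close> to be positive.\<close>
    then have Epos: "0 < E" using E by (cases "E = 0") auto
    interpret involution d "level_swap d" by (rule involution_level_swap[OF d1])
    have target: "rotate 1 (tpow 1 \<rho>) x y = tpow 1 \<sigma> x y" if "x \<in> cfg 1 d" "y \<in> cfg 1 d" for x y
      unfolding rotate_tpow
      using cfg_less[OF that(1), of 0] cfg_less[OF that(2), of 0]
      by (simp add: tpow_def rotate1_level_swap_ground[OF d1 _ _ \<rho>] \<sigma>)
    note flip = rotation_charges[where N = 1 and A = "tpow 1 \<rho>" and B = "tpow 1 \<sigma>", OF d1 Epos target]
    \<comment> \<open>The level swap sends the ground state to the top level, and its flip has
      average norm at most \<open>E\<close>, so it competes with the optimal protocol. Together with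
      \<open>1 < k * (E * T)\<close> this yields the factor \<open>pi / 2\<close>.\<close>
    have "T1 \<le> pi / (2 * E)" by (rule fastest[OF flip])
    then have "T1 / T \<le> pi / 2 * (1 / (E * T))" using T Epos by (simp add: field_simps)
    also have "1 / (E * T) < real k" using kET T Epos by (simp add: field_simps)
    also have "pi / 2 * real k \<le> pi / 2 * (real k ^ 2 * (real m - 1) + real k)"
      by (intro mult_left_mono interaction_order_le m) auto
    finally show ?thesis by simp
  qed
  show ?thesis
    unfolding E_def[symmetric]
  proof (intro conjI exI[of _ "T1 * E / a + 1"] allI impI, goal_cases)
    case 1
    then show ?case by (rule general)
  next
    case 2
    then show ?case by (elim conjE) (rule extremal)
  qed
qed

end
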